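(* $\mathsf{PFA}$ implies that $\mathsf{OGA}(X)$ holds for all regular spaces $X$ such that both $X$ and $X^2$ have countable spread.
   Context: $[X]^2$ is the collection of two-element subsets of $X$. A set $K\subseteq [X]^2$ is open if $\{\langle x,y\rangle\in X^2:\{x,y\}\in K\}$ is open in the product space $X^2$. A set $Y\subseteq X$ is $K_i$-homogeneous if $[Y]^2\subseteq K_i$. $\mathsf{OGA}(X)$ is the assertion that for every partition $[X]^{2}=K_{0}\cup K_{1}$ with $K_{0}$ open, either there is an uncountable $K_{0}$-homogeneous subset of $X$ or $X$ is the union of countably many $K_{1}$-homogeneous sets. A space has countable spread if all its discrete subspaces are countable. $\mathsf{PFA}$ is the Proper Forcing Axiom: for every proper forcing $\mathbb{P}$ and every family $\mathcal{D}$ of at most $\aleph_1$ dense subsets of $\mathbb{P}$ there is a filter on $\mathbb{P}$ meeting every member of $\mathcal{D}$. *)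

theory Defs
  imports "HOL-Analysis.Analysis" "HOL-Library.Ramsey"
begin

section \<open>The open graph axiom for a space\<close>

text \<open>The set \<open>[X]\<^sup>2\<close> of two-element subsets is \<^term>\<open>nsets X 2\<close>.\<close>

definition open_pairs :: "'a topology \<Rightarrow> 'a set set \<Rightarrow> bool" where
  "open_pairs X K \<longleftrightarrow>
     openin (prod_topology X X) {(x, y). x \<in> topspace X \<and> y \<in> topspace X \<and> {x, y} \<in> K}"

definition homogeneous :: "'a set set \<Rightarrow> 'a set \<Rightarrow> bool" where
  "homogeneous K Y \<longleftrightarrow> nsets Y 2 \<subseteq> K"

definition OGA :: "'a topology \<Rightarrow> bool" where
  "OGA X \<longleftrightarrow>
     (\<forall>K0 K1. nsets (topspace X) 2 = K0 \<union> K1 \<and> K0 \<inter> K1 = {} \<and> open_pairs X K0 \<longrightarrow>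
        (\<exists>Y \<subseteq> topspace X. uncountable Y \<and> homogeneous K0 Y) \<or>
        (\<exists>\<F>. countable \<F> \<and> (\<forall>Y \<in> \<F>. homogeneous K1 Y) \<and> \<Union>\<F> = topspace X))"

definition countable_spread :: "'a topology \<Rightarrow> bool" where
  "countable_spread X \<longleftrightarrow>
     (\<forall>Y \<subseteq> topspace X. subtopology X Y = discrete_topology Y \<longrightarrow> countable Y)"


section \<open>Proper forcing\<close>

text \<open>
  A forcing notion is a nonempty preorder on a carrier set \<open>P\<close>; \<open>le p q\<close> means that
  \<open>p\<close> is the stronger condition (\<open>p \<le> q\<close>).
\<close>

definition forcing_notion :: "'p set \<Rightarrow> ('p \<Rightarrow> 'p \<Rightarrow> bool) \<Rightarrow> bool" where
  "forcing_notion P le \<longleftrightarrow> P \<noteq> {} \<and> reflp_on P le \<and> transp_on P le"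

definition compatible :: "'p set \<Rightarrow> ('p \<Rightarrow> 'p \<Rightarrow> bool) \<Rightarrow> 'p \<Rightarrow> 'p \<Rightarrow> bool" where
  "compatible P le p q \<longleftrightarrow> (\<exists>r \<in> P. le r p \<and> le r q)"

definition dense_in :: "'p set \<Rightarrow> ('p \<Rightarrow> 'p \<Rightarrow> bool) \<Rightarrow> 'p set \<Rightarrow> bool" where
  "dense_in P le D \<longleftrightarrow> D \<subseteq> P \<and> (\<forall>p \<in> P. \<exists>d \<in> D. le d p)"

definition predense_below :: "'p set \<Rightarrow> ('p \<Rightarrow> 'p \<Rightarrow> bool) \<Rightarrow> 'p set \<Rightarrow> 'p \<Rightarrow> bool" where
  "predense_below P le A q \<longleftrightarrow> (\<forall>r \<in> P. le r q \<longrightarrow> (\<exists>a \<in> A. compatible P le r a))"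

definition filter_in :: "'p set \<Rightarrow> ('p \<Rightarrow> 'p \<Rightarrow> bool) \<Rightarrow> 'p set \<Rightarrow> bool" where
  "filter_in P le G \<longleftrightarrow>
     G \<subseteq> P \<and> G \<noteq> {} \<and>
     (\<forall>p \<in> G. \<forall>q \<in> P. le p q \<longrightarrow> q \<in> G) \<and>
     (\<forall>p \<in> G. \<forall>q \<in> G. \<exists>r \<in> G. le r p \<and> le r q)"

text \<open>Closed unbounded families of countable subsets of \<open>S\<close>, that is, clubs in \<open>[S]\<^bsup>\<le>\<omega>\<^esup>\<close>.\<close>

definition club_countable :: "'s set \<Rightarrow> 's set set \<Rightarrow> bool" where
  "club_countable S C \<longleftrightarrow>
     (\<forall>M \<in> C. M \<subseteq> S \<and> countable M) \<and>
     (\<forall>A \<subseteq> S. countable A \<longrightarrow> (\<exists>M \<in> C. A \<subseteq> M)) \<and>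
     (\<forall>f :: nat \<Rightarrow> 's set. incseq f \<and> range f \<subseteq> C \<longrightarrow> (\<Union>n. f n) \<in> C)"

text \<open>
  For a countable elementary submodel \<open>N\<close> of some \<open>H(\<theta>)\<close> with \<open>P \<in> N\<close>, genericity of a
  condition over \<open>N\<close> depends only on the elements of \<open>P\<close> and the dense subsets of \<open>P\<close>
  that belong to \<open>N\<close>, so only on the trace of \<open>N\<close> on the disjoint union of \<open>P\<close> and its
  power set. The structures \<open>H(\<theta>)\<close> are not available as HOL types; the models are therefore
  represented by these traces \<open>M\<close>, where \<open>Inl p \<in> M\<close> stands for \<open>p \<in> N\<close> and
  \<open>Inr D \<in> M\<close> for \<open>D \<in> N\<close>.
\<close>

definition generic_condition ::
    "'p set \<Rightarrow> ('p \<Rightarrow> 'p \<Rightarrow> bool) \<Rightarrow> ('p + 'p set) set \<Rightarrow> 'p \<Rightarrow> bool" where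
  "generic_condition P le M q \<longleftrightarrow>
     q \<in> P \<and>
     (\<forall>D. Inr D \<in> M \<and> dense_in P le D \<longrightarrow> predense_below P le {d \<in> D. Inl d \<in> M} q)"

text \<open>
  \<open>P\<close> is proper if for club many countable models \<open>M\<close> every condition in \<open>M\<close> has an
  \<open>(M, P)\<close>-generic extension. Since clubs of countable sets project and lift along inclusions,
  this does not depend on which set containing \<open>P\<close> and its power set the models are taken
  from, and agrees with the usual definition by countable elementary submodels of \<open>H(\<theta>)\<close>
  for all sufficiently large regular \<open>\<theta>\<close>.
\<close>

definition proper_forcing :: "'p set \<Rightarrow> ('p \<Rightarrow> 'p \<Rightarrow> bool) \<Rightarrow> bool" where
  "proper_forcing P le \<longleftrightarrow>
     forcing_notion P le \<and>
     (\<exists>C. club_countable (Inl ` P \<union> Inr ` Pow P) C \<and>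
        (\<forall>M \<in> C. \<forall>p. Inl p \<in> M \<longrightarrow> (\<exists>q. le q p \<and> generic_condition P le M q)))"

text \<open>
  HOL cannot quantify over types inside a formula, so the axiom carries the type \<open>'p\<close> from
  whose elements the forcing notions are built; it speaks about all proper forcings with at
  most as many conditions as \<open>'p\<close> has elements. The full axiom is the conjunction of all
  its instances, so assuming a single instance is assuming less than the full axiom; for spaces
  with points in \<open>'a\<close> a fixed iterated power type of \<open>'a\<close> is used, which leaves room for
  posets whose conditions involve points, sets of points and finitely many countable models.
  The cardinal \<^term>\<open>cardSuc natLeq\<close> is \<open>\<aleph>\<^sub>1\<close>.
\<close>

definition PFA :: "'p itself \<Rightarrow> bool" where
  "PFA (_ :: 'p itself) \<longleftrightarrow>
     (\<forall>(P :: 'p set) le \<D>.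
        proper_forcing P le \<and> (\<forall>D \<in> \<D>. dense_in P le D) \<and>
        (card_of \<D>, cardSuc natLeq) \<in> ordLeq \<longrightarrow>
        (\<exists>G. filter_in P le G \<and> (\<forall>D \<in> \<D>. G \<inter> D \<noteq> {})))"

end

theory Submission
  imports Defs "HOL-Library.Countable_Set_Type"
begin

text \<open>
  The axiom is applied twice, both times to a forcing notion that adds a large clique to a graph by
  finite cliques, with finite chains of countable models as side conditions. The models separate
  the points of the clique, and a point outside a model avoids all sets of the model that are small
  for a given \<open>\<sigma>\<close>-ideal. Properness amounts to an amalgamation property: every family \<open>F\<close> of
  finite cliques has a countable subfamily such that all members of \<open>F\<close>, up to a set that is null
  for the iterated ideal, are completely joined to a member of the subfamily.

  The first application shows that a regular space \<open>Y\<close> of countable spread is hereditarily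
  Lindelof: otherwise it has a subspace right-separated in type \<open>\<omega>\<^sub>1\<close>, and for the ideal of countable
  sets a generic clique gives an uncountable discrete subspace. For \<open>Y = X\<^sup>2\<close> it follows that the
  open set of pairs belonging to \<open>K\<^sub>0\<close> is a union of countably many open rectangles, so that \<open>K\<^sub>0\<close> is
  open in a second countable topology on \<open>X\<close>. The second application uses the \<open>\<sigma>\<close>-ideal generated by
  the \<open>K\<^sub>1\<close>-homogeneous sets and yields an uncountable \<open>K\<^sub>0\<close>-homogeneous set.
\<close>

section \<open>Transfer of the axiom between types, codes, and the first uncountable ordinal\<close>

unbundle cardinal_syntax

text \<open>Amalgamation suffices for properness because of how a condition \<open>r\<close> looks
  from a model \<open>N\<close> in its chain. The points of \<open>r\<close> outside
  \<open>N\<close> can be listed so that each avoids a model containing the earlier ones, so by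
  Fubini they form a tuple outside every null set in \<open>N\<close>. The tuples of the same kind
  that are joined to no member of the countable subfamily form a null set in \<open>N\<close>. Hence
  the tuple of \<open>r\<close> is joined to a member, and countability of the subfamily places a
  condition realising that member in the model.

  The two applications find the countable subfamily differently. For rectangles it is a pigeonhole,
  with one representative for each finite sequence of rectangles; a \<sigma>-ideal tolerates this
  only for countably many rectangles, which is why \<open>K0\<close> has to be reduced to countably
  many of them. In the Lindelof argument there is no countable base, and the subfamily is extracted
  from countable spread itself.

  The axiom meets only \<aleph>_1 dense sets, so largeness of the clique is always expressed as
  escaping a family of small sets \<open>B w\<close> indexed by omega1.\<close>

lemma
  assumes "club_countable S C"
  shows club_countable_cofinal: "A \<subseteq> S \<Longrightarrow> countable A \<Longrightarrow> \<exists>M\<in>C. A \<subseteq> M"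
    and club_countable_UN: "incseq f \<Longrightarrow> range f \<subseteq> C \<Longrightarrow> (\<Union>n. f n) \<in> C"
  using assms unfolding club_countable_def by simp_all

lemma club_countable_image:
  assumes C: "club_countable S C" and inj: "inj j"
  shows "club_countable (j ` S) ((`) j ` C)"
  unfolding club_countable_def
proof (intro conjI allI impI ballI)
  fix M assume "M \<in> (`) j ` C"
  then obtain M' where "M' \<in> C" "M = j ` M'" by blast
  moreover from this have "M' \<subseteq> S" "countable M'"
    using C unfolding club_countable_def by auto
  ultimately show "M \<subseteq> j ` S" "countable M" by auto
next
  fix A assume A: "A \<subseteq> j ` S" "countable A"
  have "j -` A \<subseteq> S"
  proof
    fix x assume "x \<in> j -` A"
    then have "j x \<in> j ` S" using A(1) by auto
    then show "x \<in> S" using inj_image_mem_iff[OF inj] by metis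
  qed
  moreover have "countable (j -` A)"
    using countable_image_inj_Int_vimage[OF inj A(2)] by simp
  ultimately obtain M where "M \<in> C" "j -` A \<subseteq> M"
    using club_countable_cofinal[OF C] by blast
  moreover from this have "A \<subseteq> j ` M" using A by blast
  ultimately show "\<exists>M\<in>(`) j ` C. A \<subseteq> M" by blast
next
  fix f :: "nat \<Rightarrow> _" assume f: "incseq f \<and> range f \<subseteq> (`) j ` C"
  define g where "g n = j -` f n" for n
  have jg: "j ` g n = f n" and gC: "g n \<in> C" for n
  proof -
    have "f n \<in> (`) j ` C" using f by auto
    then obtain M where "M \<in> C" "f n = j ` M" by blast
    moreover from this have "g n = M" using inj by (auto simp: g_def inj_eq)
    ultimately show "j ` g n = f n" "g n \<in> C" by auto
  qed
  have "incseq g" using f by (auto simp: g_def incseq_def)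
  then have "(\<Union>n. g n) \<in> C" using club_countable_UN[OF C] gC by blast
  moreover have "(\<Union>n. f n) = j ` (\<Union>n. g n)" using jg by (simp add: image_UN)
  ultimately show "(\<Union>n. f n) \<in> (`) j ` C" by blast
qed

lemma inj_image: "inj f \<Longrightarrow> inj (image f)"
  by (simp add: inj_on_def inj_image_eq_iff)

text \<open>A forcing over the smaller type is copied onto the image of \<open>f\<close>.
  Conditions, dense sets and models correspond along \<open>f\<close>, \<open>image f\<close> and
  \<open>map_sum f (image f)\<close>, and a filter on the copy is pulled back as a preimage.\<close>

lemma PFA_inj:
  fixes f :: "'q \<Rightarrow> 'p"
  assumes inj: "inj f" and pfa: "PFA TYPE('p)"
  shows "PFA TYPE('q)"
  unfolding PFA_def
proof (intro allI impI, elim conjE)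
  fix P :: "'q set" and le \<D>
  assume proper: "proper_forcing P le" and dense: "\<forall>D\<in>\<D>. dense_in P le D"
    and card: "|\<D>| \<le>o cardSuc natLeq"
  define g where "g = inv f"
  have gf [simp]: "g (f x) = x" for x using inj by (simp add: g_def)
  define le' where "le' = (\<lambda>a b. le (g a) (g b))"
  define j where "j = map_sum f (image f)"
  have "inj j" unfolding j_def by (intro sum.inj_map inj inj_image)
  have mem [simp]: "f x \<in> f ` A \<longleftrightarrow> x \<in> A" for x A using inj by (auto simp: inj_eq)
  have dense_f: "dense_in (f ` P) le' (f ` D) \<longleftrightarrow> dense_in P le D" for D
    unfolding dense_in_def le'_def ball_simps bex_simps gf inj_image_subset_iff[OF inj] ..
  have compat_f: "compatible (f ` P) le' (f a) (f b) \<longleftrightarrow> compatible P le a b" for a b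
    by (auto simp: compatible_def le'_def)
  have "proper_forcing (f ` P) le'"
    unfolding proper_forcing_def
  proof (intro conjI)
    show "forcing_notion (f ` P) le'"
    proof -
      have "P \<noteq> {}" "reflp_on P le" "transp_on P le"
        using proper by (auto simp: proper_forcing_def forcing_notion_def)
      then show ?thesis unfolding forcing_notion_def le'_def reflp_on_def transp_on_def ball_simps gf
        by blast
    qed
    obtain C where C: "club_countable (Inl ` P \<union> Inr ` Pow P) C"
      and gen: "\<And>M p. M \<in> C \<Longrightarrow> Inl p \<in> M \<Longrightarrow> \<exists>q. le q p \<and> generic_condition P le M q"
      using proper unfolding proper_forcing_def by blast
    have S: "j ` (Inl ` P \<union> Inr ` Pow P) = Inl ` f ` P \<union> Inr ` Pow (f ` P)"
    proof -
      have "Pow (f ` P) = image f ` Pow P" by (auto simp: subset_image_iff)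
      then show ?thesis by (auto simp: j_def image_Un image_image)
    qed
    show "\<exists>C. club_countable (Inl ` f ` P \<union> Inr ` Pow (f ` P)) C \<and>
        (\<forall>M\<in>C. \<forall>p. Inl p \<in> M \<longrightarrow> (\<exists>q. le' q p \<and> generic_condition (f ` P) le' M q))"
    proof (rule exI[of _ "(`) j ` C"], intro conjI ballI allI impI)
      show "club_countable (Inl ` f ` P \<union> Inr ` Pow (f ` P)) ((`) j ` C)"
        using club_countable_image[OF C \<open>inj j\<close>] S by simp
      fix M' p' assume "M' \<in> (`) j ` C" and p': "Inl p' \<in> M'"
      then obtain M where M: "M \<in> C" "M' = j ` M" by blast
      have InlM: "Inl (f a) \<in> j ` M \<longleftrightarrow> Inl a \<in> M" for a
      proof -
        have "Inl (f a) = j (Inl a)" by (simp add: j_def)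
        then show ?thesis using \<open>inj j\<close> by (metis inj_image_mem_iff)
      qed
      obtain p where p: "Inl p \<in> M" "p' = f p"
      proof -
        obtain z where z: "z \<in> M" "Inl p' = j z" using p' M(2) by blast
        then show ?thesis using that by (cases z) (auto simp: j_def)
      qed
      obtain q where q: "le q p" "generic_condition P le M q" using gen[OF M(1) p(1)] by blast
      have "generic_condition (f ` P) le' M' (f q)"
        unfolding generic_condition_def predense_below_def
      proof (intro conjI allI impI ballI)
        show "f q \<in> f ` P" using q(2) by (simp add: generic_condition_def)
        fix D' r' assume D': "Inr D' \<in> M' \<and> dense_in (f ` P) le' D'" and r': "r' \<in> f ` P" "le' r' (f q)"
        obtain D where D: "Inr D \<in> M" "D' = f ` D"
        proof -
          obtain z where z: "z \<in> M" "Inr D' = j z" using D' M(2) by blast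
          then show ?thesis using that by (cases z) (auto simp: j_def)
        qed
        obtain r where r: "r \<in> P" "r' = f r" "le r q" using r' by (auto simp: le'_def)
        have "dense_in P le D" using D' D(2) dense_f by simp
        then obtain a where "a \<in> D" "Inl a \<in> M" "compatible P le r a"
          using q(2) D(1) r unfolding generic_condition_def predense_below_def by blast
        then show "\<exists>a\<in>{d \<in> D'. Inl d \<in> M'}. compatible (f ` P) le' r' a"
          using D(2) M(2) r(2) compat_f InlM by (intro bexI[of _ "f a"]) auto
      qed
      moreover have "le' (f q) p'" using q(1) p(2) by (simp add: le'_def)
      ultimately show "\<exists>q. le' q p' \<and> generic_condition (f ` P) le' M' q" by blast
    qed
  qed
  moreover have "\<forall>D\<in>image f ` \<D>. dense_in (f ` P) le' D"
    using dense dense_f by auto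
  moreover have "|image f ` \<D>| \<le>o cardSuc natLeq"
    using card card_of_image ordLeq_transitive by blast
  ultimately obtain G where G: "filter_in (f ` P) le' G" "\<forall>D\<in>image f ` \<D>. G \<inter> D \<noteq> {}"
    using pfa unfolding PFA_def by meson
  have "filter_in P le (f -` G)"
  proof -
    have GP: "G \<subseteq> f ` P" "G \<noteq> {}" and up: "\<And>p q. p \<in> G \<Longrightarrow> q \<in> f ` P \<Longrightarrow> le' p q \<Longrightarrow> q \<in> G"
      and dir: "\<And>p q. p \<in> G \<Longrightarrow> q \<in> G \<Longrightarrow> \<exists>r\<in>G. le' r p \<and> le' r q"
      using G(1) unfolding filter_in_def by blast+
    show ?thesis unfolding filter_in_def
    proof (intro conjI ballI impI)
      show "f -` G \<subseteq> P" using GP(1) by (metis mem subsetD subsetI vimageE)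
      show "f -` G \<noteq> {}" using GP by blast
      show "q \<in> f -` G" if "p \<in> f -` G" "q \<in> P" "le p q" for p q
        using up[of "f p" "f q"] that by (auto simp: le'_def)
      show "\<exists>r\<in>f -` G. le r p \<and> le r q" if pq: "p \<in> f -` G" "q \<in> f -` G" for p q
      proof -
        obtain r where r: "r \<in> G" "le' r (f p)" "le' r (f q)" using dir pq by blast
        moreover obtain s where "r = f s" using r(1) GP(1) by blast
        ultimately show ?thesis by (auto simp: le'_def)
      qed
    qed
  qed
  moreover have "f -` G \<inter> D \<noteq> {}" if "D \<in> \<D>" for D
    using bspec[OF G(2) imageI[OF that]] by auto
  ultimately show "\<exists>G. filter_in P le G \<and> (\<forall>D\<in>\<D>. G \<inter> D \<noteq> {})" by blast
qed

section \<open>Injections into iterated power types\<close>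

lemma ex_inj_iff_ordLeq: "(\<exists>f :: 'x \<Rightarrow> 'y. inj f) \<longleftrightarrow> |(UNIV :: 'x set)| \<le>o |(UNIV :: 'y set)|"
  using card_of_ordLeq[of "UNIV :: 'x set" "UNIV :: 'y set"] by auto

lemma ex_inj_Times:
  assumes "\<exists>f :: 'x \<Rightarrow> 'z. inj f" "\<exists>f :: 'y \<Rightarrow> 'z. inj f" "infinite (UNIV :: 'z set)"
  shows "\<exists>f :: 'x \<times> 'y \<Rightarrow> 'z. inj f"
proof -
  obtain f :: "'x \<Rightarrow> 'z" and g :: "'y \<Rightarrow> 'z" where fg: "inj f" "inj g" using assms by blast
  have "|(UNIV :: 'z set) \<times> (UNIV :: 'z set)| \<le>o |(UNIV :: 'z set)|"
    using card_of_Times_same_infinite[OF assms(3)] ordIso_imp_ordLeq by blast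
  then obtain h :: "'z \<times> 'z \<Rightarrow> 'z" where h: "inj h"
    using ex_inj_iff_ordLeq[where 'x = "'z \<times> 'z" and 'y = 'z] by auto
  have "inj (\<lambda>p. h (f (fst p), g (snd p)))"
    by (intro injI prod_eqI) (simp_all add: inj_eq[OF h] inj_eq[OF fg(1)] inj_eq[OF fg(2)])
  then show ?thesis by blast
qed

lemma ex_inj_nat:
  assumes "infinite (UNIV :: 'z set)"
  shows "\<exists>f :: nat \<Rightarrow> 'z. inj f"
  using infinite_countable_subset[OF assms] by blast

text \<open>A list of sets is stored as one set of tagged pairs: \<open>(Suc i, y)\<close> for a
  member \<open>y\<close> of entry \<open>i\<close>, and \<open>(0, e k)\<close> for each
  \<open>k\<close> below the length. The tag \<open>0\<close> records the length, since trailing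
  empty entries leave no other trace.\<close>

lemma ex_inj_list_set:
  assumes "infinite (UNIV :: 'z set)"
  shows "\<exists>f :: 'z set list \<Rightarrow> 'z set. inj f"
proof -
  obtain e :: "nat \<Rightarrow> 'z" where e: "inj e" using ex_inj_nat[OF assms] by blast
  moreover have "\<exists>f :: 'z \<Rightarrow> 'z. inj f" by (auto intro: exI[of _ id])
  ultimately obtain h :: "nat \<times> 'z \<Rightarrow> 'z" where h: "inj h"
    using ex_inj_Times[OF _ _ assms] by blast
  define c where "c xs = h ` ({(0, e k) | k. k < length xs} \<union> {(Suc i, y) | i y. i < length xs \<and> y \<in> xs ! i})" for xs
  have "xs = ys" if eq: "c xs = c ys" for xs ys
  proof -
    define d where "d xs = {(0, e k) | k. k < length xs} \<union> {(Suc i, y) | i y. i < length xs \<and> y \<in> xs ! i}" for xs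
    have deq: "d xs = d ys" using eq h by (simp add: c_def d_def inj_image_eq_iff)
    have "{k. (0, e k) \<in> d zs} = {..<length zs}" for zs
      using e by (auto simp: d_def inj_eq)
    then have len: "length xs = length ys" using deq by (metis lessThan_eq_iff)
    have "{y. (Suc i, y) \<in> d zs} = zs ! i" if "i < length zs" for zs i
      using that by (auto simp: d_def)
    then show ?thesis using len deq by (metis nth_equalityI)
  qed
  then show ?thesis by (intro exI[of _ c]) (auto simp: inj_on_def)
qed

lemma ex_inj_set: "\<exists>f :: 'z \<Rightarrow> 'z set. inj f"
  by (rule exI[of _ "\<lambda>x. {x}"]) (auto simp: inj_def)

text \<open>Origin of the four powers in the axiom: lists over \<open>'b\<close> fit into
  \<open>'a set\<close>, and finite sets of models, being sets of sets of sets of lists, cost three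
  more. Sets of points fit into two powers and are padded by singletons.\<close>

lemma ex_inj_conditions:
  assumes inf: "infinite (UNIV :: 'a set)" and g: "\<exists>g :: 'b \<Rightarrow> 'a set. inj g"
  shows "\<exists>f :: 'b set \<times> 'b list set set set \<Rightarrow> 'a set set set set. inj f"
proof (rule ex_inj_Times)
  obtain g :: "'b \<Rightarrow> 'a set" where g: "inj g" using assms by blast
  obtain s :: "'a set set \<Rightarrow> 'a set set set" where s: "inj s" using ex_inj_set by blast
  obtain s' :: "'a set set set \<Rightarrow> 'a set set set set" where s': "inj s'" using ex_inj_set by blast
  have "inj (s' \<circ> s \<circ> image g)" using g s s' by (intro inj_compose inj_image)
  then show "\<exists>f :: 'b set \<Rightarrow> 'a set set set set. inj f" by blast
  obtain l :: "'a set list \<Rightarrow> 'a set" where l: "inj l" using ex_inj_list_set[OF inf] by blast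
  have "inj (image (image (image (l \<circ> map g))))"
    using g l by (intro inj_compose inj_image) auto
  then show "\<exists>f :: 'b list set set set \<Rightarrow> 'a set set set set. inj f" by blast
  show "infinite (UNIV :: 'a set set set set set)"
    using inf by (simp add: Finite_Set.finite_set)
qed

text \<open>The enumeration \<open>from_nat_into N\<close> turns the family into a set of pairs
  (index, element). The empty family is left out because the range of an enumeration is never
  empty.\<close>

lemma ex_code_countable:
  assumes "infinite (UNIV :: 'b set)"
  shows "\<exists>c :: 'b set set \<Rightarrow> 'b set. inj_on c {N. countable N \<and> N \<noteq> {}}"
proof -
  have "\<exists>f :: nat \<Rightarrow> 'b. inj f" by (rule ex_inj_nat[OF assms])
  moreover have "\<exists>f :: 'b \<Rightarrow> 'b. inj f" by (auto intro: exI[of _ id])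
  ultimately obtain f :: "nat \<times> 'b \<Rightarrow> 'b" where f: "inj f"
    using ex_inj_Times[OF _ _ assms] by blast
  define c where "c N = f ` {(k, y). y \<in> from_nat_into N k}" for N
  have "N = N'" if N: "countable N" "N \<noteq> {}" "countable N'" "N' \<noteq> {}" and eq: "c N = c N'" for N N'
  proof -
    have "{(k, y). y \<in> from_nat_into N k} = {(k, y). y \<in> from_nat_into N' k}"
      using eq f by (simp add: c_def inj_image_eq_iff)
    then have "from_nat_into N k = from_nat_into N' k" for k by blast
    then have "range (from_nat_into N) = range (from_nat_into N')" by presburger
    then show ?thesis using N by (simp add: range_from_nat_into)
  qed
  then show ?thesis by (intro exI[of _ c]) (auto simp: inj_on_def)
qed

section \<open>The first uncountable ordinal, realised as a well-order on sets of naturals\<close>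

abbreviation omega1 :: "nat set rel" where "omega1 \<equiv> cardSuc natLeq"

lemma Well_order_omega1: "Well_order omega1"
  using cardSuc_Well_order natLeq_Card_order by blast

lemma
  shows trans_omega1: "(u, v) \<in> omega1 \<Longrightarrow> (v, w) \<in> omega1 \<Longrightarrow> (u, w) \<in> omega1"
    and refl_omega1: "u \<in> Field omega1 \<Longrightarrow> (u, u) \<in> omega1"
    and total_omega1: "u \<in> Field omega1 \<Longrightarrow> v \<in> Field omega1 \<Longrightarrow> (u, v) \<in> omega1 \<or> (v, u) \<in> omega1"
    and wf_omega1: "wf (omega1 - Id)"
proof -
  have *: "trans omega1" "refl_on (Field omega1) omega1" "total_on (Field omega1) omega1"
    "wf (omega1 - Id)"
    using Well_order_omega1
    unfolding well_order_on_def linear_order_on_def partial_order_on_def preorder_on_def by auto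
  show "(u, v) \<in> omega1 \<Longrightarrow> (v, w) \<in> omega1 \<Longrightarrow> (u, w) \<in> omega1"
    using *(1) by (rule transD)
  show u: "u \<in> Field omega1 \<Longrightarrow> (u, u) \<in> omega1" for u
    using *(2) by (rule refl_onD)
  show "u \<in> Field omega1 \<Longrightarrow> v \<in> Field omega1 \<Longrightarrow> (u, v) \<in> omega1 \<or> (v, u) \<in> omega1"
    using *(3) u unfolding total_on_def by metis
  show "wf (omega1 - Id)" by fact
qed

lemma uncountable_omega1: "uncountable (Field omega1)"
proof
  assume "countable (Field omega1)"
  then have "|Field omega1| \<le>o natLeq"
    by (metis card_of_nat countable_card_of_nat ordLeq_ordIso_trans)
  moreover have "natLeq <o |Field omega1|"
    using cardSuc_greater[OF natLeq_Card_order] card_of_Field_ordIso[OF cardSuc_Card_order[OF natLeq_Card_order]]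
      ordIso_symmetric ordLess_ordIso_trans by blast
  ultimately show False using not_ordLeq_ordLess by blast
qed

lemma countable_under_omega1: "countable {v. (v, w) \<in> omega1}"
proof (cases "w \<in> Field omega1")
  case True
  have "|{v. (v, w) \<in> omega1} - {w}| <o omega1"
    using card_of_underS[OF cardSuc_Card_order[OF natLeq_Card_order] True]
    by (simp add: underS_def set_diff_eq conj_commute)
  then have "|{v. (v, w) \<in> omega1} - {w}| \<le>o natLeq"
    using cardSuc_ordLess_ordLeq[OF natLeq_Card_order] cardSuc_ordLeq_ordLess[OF natLeq_Card_order card_of_Card_order]
    by blast
  then have "countable ({v. (v, w) \<in> omega1} - {w})"
    by (metis card_of_nat countable_card_of_nat ordIso_symmetric ordLeq_ordIso_trans)
  then show ?thesis by (simp add: countable_Diff_eq)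
next
  case False
  then have "{v. (v, w) \<in> omega1} = {}" by (auto simp: Field_def)
  then show ?thesis by (metis countable_empty)
qed

lemma countable_bounded_omega1:
  assumes "countable A"
  shows "\<exists>w\<in>Field omega1. A \<inter> Field omega1 \<subseteq> {v. (v, w) \<in> omega1 - Id}"
proof -
  have "countable (\<Union>v\<in>A. {u. (u, v) \<in> omega1})"
    using assms countable_under_omega1 by (intro countable_UN) auto
  then obtain w where w: "w \<in> Field omega1" "w \<notin> (\<Union>v\<in>A. {u. (u, v) \<in> omega1})"
    using uncountable_omega1 countable_subset by (metis subsetI)
  then have "A \<inter> Field omega1 \<subseteq> {v. (v, w) \<in> omega1 - Id}"
    using total_omega1 refl_omega1 by blast
  then show ?thesis using w(1) by blast
qed


section \<open>Countable models and iterated null sets\<close>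

primrec hull_stage :: "('u set \<Rightarrow> 'u set) \<Rightarrow> 'u set \<Rightarrow> nat \<Rightarrow> 'u set" where
  "hull_stage op A 0 = A"
| "hull_stage op A (Suc n) = hull_stage op A n \<union> \<Union>(op ` {e. finite e \<and> e \<subseteq> hull_stage op A n})"

definition op_hull :: "('u set \<Rightarrow> 'u set) \<Rightarrow> 'u set \<Rightarrow> 'u set" where
  "op_hull op A = (\<Union>n. hull_stage op A n)"

definition op_closed :: "('u set \<Rightarrow> 'u set) \<Rightarrow> 'u set \<Rightarrow> bool" where
  "op_closed op K \<longleftrightarrow> (\<forall>e. finite e \<and> e \<subseteq> K \<longrightarrow> op e \<subseteq> K)"

lemma finite_subset_UN_incseq:
  assumes "finite e" "e \<subseteq> (\<Union>n. X n)" "incseq X"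
  shows "\<exists>n::nat. e \<subseteq> X n"
  using assms(1,2)
proof induction
  case (insert x e)
  then obtain m n where "e \<subseteq> X m" "x \<in> X n" by auto
  then have "insert x e \<subseteq> X (max m n)"
    using incseqD[OF assms(3), of m "max m n"] incseqD[OF assms(3), of n "max m n"] by auto
  then show ?case by blast
qed simp

lemma op_hull_superset: "A \<subseteq> op_hull op A"
  unfolding op_hull_def by (metis UNIV_I UN_upper hull_stage.simps(1))

lemma op_closed_hull: "op_closed op (op_hull op A)"
  unfolding op_closed_def
proof (intro allI impI)
  fix e assume e: "finite e \<and> e \<subseteq> op_hull op A"
  have "incseq (hull_stage op A)" by (rule incseq_SucI) auto
  then obtain n where n: "e \<subseteq> hull_stage op A n"
    using finite_subset_UN_incseq[of e] e unfolding op_hull_def by blast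
  then have "op e \<subseteq> hull_stage op A (Suc n)" using e by auto
  then show "op e \<subseteq> op_hull op A" unfolding op_hull_def by blast
qed

lemma op_hull_least:
  assumes "A \<subseteq> K" "op_closed op K"
  shows "op_hull op A \<subseteq> K"
proof -
  have "hull_stage op A n \<subseteq> K" for n
  proof (induction n)
    case (Suc n)
    then have "op e \<subseteq> K" if "finite e" "e \<subseteq> hull_stage op A n" for e
      using assms(2) that unfolding op_closed_def by blast
    then show ?case using Suc by auto
  qed (use assms in simp)
  then show ?thesis unfolding op_hull_def by blast
qed

lemma op_hull_mono: "A \<subseteq> B \<Longrightarrow> op_hull op A \<subseteq> op_hull op B"
  using op_hull_least[OF _ op_closed_hull] op_hull_superset by (metis order_trans)

lemma countable_op_hull:
  assumes "\<And>e. finite e \<Longrightarrow> countable (op e)" "countable A"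
  shows "countable (op_hull op A)"
proof -
  have "countable (hull_stage op A n)" for n
  proof (induction n)
    case (Suc n)
    have "countable {e. finite e \<and> e \<subseteq> hull_stage op A n}"
      using countable_Collect_finite_subset[OF Suc] by simp
    then show ?case using Suc assms(1) by auto
  qed (use assms in simp)
  then show ?thesis unfolding op_hull_def by auto
qed

text \<open>This plays the role of Loewenheim-Skolem. Left summands are auxiliary objects, right
  summands contain the set \<open>S\<close> on which the club lives. A countable \<open>M\<close> is
  in the club when the hull generated by \<open>M\<close> adds no new element of \<open>S\<close>;
  that hull is then the model with trace \<open>M\<close>.\<close>

lemma club_countable_closed_traces:
  fixes op :: "('o + 's) set \<Rightarrow> ('o + 's) set"
  assumes op: "\<And>e. finite e \<Longrightarrow> countable (op e)"
  shows "\<exists>C. club_countable S C \<and> (\<forall>M\<in>C. \<exists>K. countable K \<and> op_closed op K \<and> Inr -` K \<inter> S = M)"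
proof -
  define H where "H M = op_hull op (Inr ` M)" for M :: "'s set"
  define C where "C = {M. M \<subseteq> S \<and> countable M \<and> Inr -` H M \<inter> S \<subseteq> M}"
  have cH: "countable (H M)" if "countable M" for M
    using countable_op_hull[of op, OF op] that by (simp add: H_def)
  have sup: "M \<subseteq> Inr -` H M" for M using op_hull_superset[of "Inr ` M" op] unfolding H_def by blast
  have cl: "op_closed op (H M)" for M unfolding H_def by (rule op_closed_hull)
  have mono: "H M \<subseteq> H M'" if "M \<subseteq> M'" for M M'
    unfolding H_def using that by (intro op_hull_mono image_mono)
  have "club_countable S C" unfolding club_countable_def
  proof (intro conjI allI impI ballI)
    fix M assume "M \<in> C" then show "M \<subseteq> S" "countable M" by (auto simp: C_def)
  next
    fix A assume A: "A \<subseteq> S" "countable A"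
    define M where "M = Inr -` H A \<inter> S"
    have "countable M"
      using countable_image_inj_Int_vimage[of Inr UNIV "H A"] cH[OF A(2)] unfolding M_def by auto
    moreover have "H M \<subseteq> H A" 
      unfolding H_def[of M] using cl by (intro op_hull_least) (auto simp: M_def)
    ultimately have "M \<in> C" unfolding C_def M_def by auto
    moreover have "A \<subseteq> M" using A sup unfolding M_def by blast
    ultimately show "\<exists>M\<in>C. A \<subseteq> M" by blast
  next
    fix f :: "nat \<Rightarrow> 's set" assume f: "incseq f \<and> range f \<subseteq> C"
    have inc: "incseq (\<lambda>n. H (f n))" using f by (auto simp: incseq_def intro!: mono)
    have "op_closed op (\<Union>n. H (f n))" unfolding op_closed_def
    proof (intro allI impI)
      fix e assume e: "finite e \<and> e \<subseteq> (\<Union>n. H (f n))"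
      then obtain n where "e \<subseteq> H (f n)" using finite_subset_UN_incseq[OF _ _ inc] by blast
      then have "op e \<subseteq> H (f n)" using cl e unfolding op_closed_def by blast
      then show "op e \<subseteq> (\<Union>n. H (f n))" by blast
    qed
    moreover have "Inr ` (\<Union>n. f n) \<subseteq> (\<Union>n. H (f n))" using sup by blast
    ultimately have HU: "H (\<Union>n. f n) \<subseteq> (\<Union>n. H (f n))"
      unfolding H_def[of "\<Union>n. f n"] by (rule op_hull_least[rotated])
    have f': "Inr -` H (f n) \<inter> S \<subseteq> f n" "f n \<subseteq> S" "countable (f n)" for n
      using f by (auto simp: C_def)
    have "Inr -` H (\<Union>n. f n) \<inter> S \<subseteq> (\<Union>n. Inr -` H (f n) \<inter> S)" using HU by blast
    also have "\<dots> \<subseteq> (\<Union>n. f n)" using f'(1) by (intro UN_mono) auto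
    finally show "(\<Union>n. f n) \<in> C" using f'(2,3) unfolding C_def by (simp add: UN_least)
  qed
  moreover have "\<exists>K. countable K \<and> op_closed op K \<and> Inr -` K \<inter> S = M" if "M \<in> C" for M
  proof (intro exI conjI)
    have M: "M \<subseteq> S" "countable M" "Inr -` H M \<inter> S \<subseteq> M" using that by (auto simp: C_def)
    show "countable (H M)" by (rule cH[OF M(2)])
    show "op_closed op (H M)" by (rule cl)
    show "Inr -` H M \<inter> S = M" using M(1,3) sup[of M] by blast
  qed
  ultimately show ?thesis by blast
qed

section \<open>Sections, Fubini powers and points avoiding a model\<close>

definition sec :: "'b list set \<Rightarrow> 'b \<Rightarrow> 'b list set" where
  "sec G x = {xs. x # xs \<in> G}"

text \<open>Points become sets of lists, so that a model is a single family whose members represent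
  points, sets of tuples and smaller models alike.\<close>

definition pt :: "'b \<Rightarrow> 'b list set" where
  "pt x = {[x]}"

lemma inj_pt: "inj pt"
  by (auto simp: inj_def pt_def)

text \<open>
  A countable family of sets of lists is coded by a single set of lists, so that \<open>code N \<in> N'\<close> can
  express that the model \<open>N\<close> is an element of the model \<open>N'\<close>.
\<close>

definition code :: "'b list set set \<Rightarrow> 'b list set" where
  "code = (SOME c. inj_on c {N. countable N \<and> N \<noteq> {}})"

lemma inj_on_code: "inj_on (code :: 'b list set set \<Rightarrow> 'b list set) {N. countable N \<and> N \<noteq> {}}"
  unfolding code_def by (rule someI_ex[OF ex_code_countable]) (rule infinite_UNIV_listI)

locale sigma_ideal =
  fixes I :: "'b set set"
  assumes I_mono: "A \<in> I \<Longrightarrow> B \<subseteq> A \<Longrightarrow> B \<in> I"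
    and I_Union: "countable \<A> \<Longrightarrow> \<A> \<subseteq> I \<Longrightarrow> \<Union>\<A> \<in> I"
    and I_proper: "UNIV \<notin> I"
begin

text \<open>On sets of lists of length \<open>n\<close>, \<open>null n\<close> is the \<open>n\<close>-fold Fubini power of the ideal.\<close>

primrec null :: "nat \<Rightarrow> 'b list set \<Rightarrow> bool" where
  "null 0 G \<longleftrightarrow> [] \<notin> G"
| "null (Suc n) G \<longleftrightarrow> {x. \<not> null n (sec G x)} \<in> I"

lemma null_mono: "null n G \<Longrightarrow> H \<subseteq> G \<Longrightarrow> null n H"
proof (induction n arbitrary: G H)
  case (Suc n)
  have "sec H x \<subseteq> sec G x" for x using Suc.prems by (auto simp: sec_def)
  then have "{x. \<not> null n (sec H x)} \<subseteq> {x. \<not> null n (sec G x)}" using Suc.IH by blast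
  then show ?case using Suc.prems I_mono by simp
qed auto

lemma null_UN: "countable J \<Longrightarrow> (\<And>j. j \<in> J \<Longrightarrow> null n (G j)) \<Longrightarrow> null n (\<Union>j\<in>J. G j)"
proof (induction n arbitrary: G)
  case (Suc n)
  have "{x. \<not> null n (sec (\<Union>j\<in>J. G j) x)} \<subseteq> (\<Union>j\<in>J. {x. \<not> null n (sec (G j) x)})"
  proof
    fix x assume "x \<in> {x. \<not> null n (sec (\<Union>j\<in>J. G j) x)}"
    moreover have "sec (\<Union>j\<in>J. G j) x = (\<Union>j\<in>J. sec (G j) x)" by (auto simp: sec_def)
    ultimately show "x \<in> (\<Union>j\<in>J. {x. \<not> null n (sec (G j) x)})"
      using Suc.IH[of "\<lambda>j. sec (G j) x"] Suc.prems(1) by auto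
  qed
  moreover have "(\<Union>j\<in>J. {x. \<not> null n (sec (G j) x)}) \<in> I"
    using Suc.prems by (intro I_Union) auto
  ultimately show ?case using I_mono by simp
qed auto

text \<open>For \<open>x\<close> outside \<open>Z\<close> the section at \<open>x\<close> is the
  same set in one dimension less, so only the small set \<open>Z\<close> of first coordinates is
  exceptional.\<close>

lemma null_coordinate:
  assumes "Z \<in> I"
  shows "null n {xs. length xs = n \<and> (\<exists>x\<in>set xs. x \<in> Z)}"
proof (induction n)
  case (Suc n)
  have "{x. \<not> null n (sec {xs. length xs = Suc n \<and> (\<exists>x\<in>set xs. x \<in> Z)} x)} \<subseteq> Z"
  proof (rule subsetI, rule ccontr)
    fix x assume x: "x \<in> {x. \<not> null n (sec {xs. length xs = Suc n \<and> (\<exists>x\<in>set xs. x \<in> Z)} x)}" "x \<notin> Z"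
    then have "sec {xs. length xs = Suc n \<and> (\<exists>x\<in>set xs. x \<in> Z)} x = {xs. length xs = n \<and> (\<exists>x\<in>set xs. x \<in> Z)}"
      by (auto simp: sec_def)
    then show False using x Suc by simp
  qed
  then show ?case using I_mono assms by simp
qed simp

text \<open>The exceptional set of Fubini's theorem, written with lists of length one so that it has
  the type of \<open>G\<close> and can belong to the same model.\<close>

definition bad :: "nat \<Rightarrow> 'b list set \<Rightarrow> 'b list set" where
  "bad n G = (\<lambda>x. [x]) ` {x. \<not> null n (sec G x)}"

lemma null_1: "null (Suc 0) Z \<longleftrightarrow> {x. [x] \<in> Z} \<in> I"
  by (simp add: sec_def)

text \<open>The closure clauses are the fragment of elementarity that the argument uses: exceptional
  sets, sections at points of the model, and the rule that a countable element of a model is a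
  subset of it.\<close>

definition model :: "'b list set set \<Rightarrow> bool" where
  "model N \<longleftrightarrow> countable N \<and> N \<noteq> {} \<and> (\<forall>G\<in>N. \<forall>n. bad n G \<in> N) \<and>
     (\<forall>G\<in>N. \<forall>x. pt x \<in> N \<longrightarrow> sec G x \<in> N) \<and>
     (\<forall>N'. countable N' \<and> N' \<noteq> {} \<and> code N' \<in> N \<longrightarrow> N' \<subseteq> N)"

text \<open>Genericity of \<open>x\<close> over \<open>N\<close> for the ideal, as a random real is
  generic over a model for the ideal of measure zero sets.\<close>

definition avoids :: "'b \<Rightarrow> 'b list set set \<Rightarrow> bool" where
  "avoids x N \<longleftrightarrow> (\<forall>Z\<in>N. null (Suc 0) Z \<longrightarrow> [x] \<notin> Z)"

lemma model_bad: "model N \<Longrightarrow> G \<in> N \<Longrightarrow> bad n G \<in> N"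
  and model_sec: "model N \<Longrightarrow> G \<in> N \<Longrightarrow> pt x \<in> N \<Longrightarrow> sec G x \<in> N"
  and model_code: "model N \<Longrightarrow> model N' \<Longrightarrow> code N' \<in> N \<Longrightarrow> N' \<subseteq> N"
  by (auto simp: model_def)

lemma ex_avoids:
  assumes "countable N"
  shows "\<exists>x. avoids x N"
proof -
  have "(\<Union>Z\<in>{Z \<in> N. null (Suc 0) Z}. {x. [x] \<in> Z}) \<in> I"
    using assms by (intro I_Union) (auto simp: null_1 simp del: null.simps)
  then obtain x where "x \<notin> (\<Union>Z\<in>{Z \<in> N. null (Suc 0) Z}. {x. [x] \<in> Z})"
    using I_proper by (metis UNIV_eq_I)
  then show ?thesis by (auto simp: avoids_def)
qed

lemma avoids_null_section:
  assumes "model N" "avoids x N" "G \<in> N" "null (Suc n) G"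
  shows "null n (sec G x)"
proof -
  have "null (Suc 0) (bad n G)" using assms(4) by (simp add: null_1 bad_def image_iff del: null.simps) simp
  then have "[x] \<notin> bad n G" using assms model_bad unfolding avoids_def by blast
  then show ?thesis by (auto simp: bad_def)
qed

text \<open>The points are listed in the order in which the chain of models absorbs them. A minimal
  model \<open>N1\<close> containing a point of \<open>D\<close> contains exactly one,
  \<open>x\<close>, since two would be separated by a smaller model. As \<open>x\<close> avoids
  \<open>N0\<close>, the section at \<open>x\<close> of a null set \<open>G\<close> in
  \<open>N0\<close> is null. This section lies in \<open>N1\<close>, over which the remaining points
  are listed by induction.\<close>

lemma avoids_enumeration:
  assumes "finite D" "finite \<N>" "N0 \<in> \<N>" "\<And>N. N \<in> \<N> \<Longrightarrow> model N"
    "\<And>N N'. N \<in> \<N> \<Longrightarrow> N' \<in> \<N> \<Longrightarrow> N \<subseteq> N' \<or> N' \<subseteq> N"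
    "\<And>x N. x \<in> D \<Longrightarrow> N \<in> \<N> \<Longrightarrow> pt x \<in> N \<or> avoids x N"
    "\<And>x y. x \<in> D \<Longrightarrow> y \<in> D \<Longrightarrow> x \<noteq> y \<Longrightarrow> \<exists>N\<in>\<N>. (pt x \<in> N) \<noteq> (pt y \<in> N)"
    "\<And>x. x \<in> D \<Longrightarrow> pt x \<notin> N0"
  shows "\<exists>xs. set xs = D \<and> distinct xs \<and> (\<forall>G\<in>N0. null (length xs) G \<longrightarrow> xs \<notin> G)"
  using assms(1,3,6-)
proof (induction "card D" arbitrary: D N0)
  case 0
  then show ?case by simp
next
  case (Suc n)
  then obtain x0 where x0: "x0 \<in> D" by fastforce
  show ?case
  proof (cases "D = {x0}")
    \<comment> \<open>The last point may lie in no model at all, so a single point is treated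
      without choosing \<open>N1\<close>.\<close>
    case True
    have "[x0] \<notin> G" if "G \<in> N0" "null (Suc 0) G" for G
      using Suc.prems(3)[OF x0 Suc.prems(2)] Suc.prems(5)[OF x0] that unfolding avoids_def by blast
    then show ?thesis using True by (intro exI[of _ "[x0]"]) auto
  next
    case False
    define \<N>' where "\<N>' = {N \<in> \<N>. \<exists>x\<in>D. pt x \<in> N}"
    obtain y where "y \<in> D" "y \<noteq> x0" using False x0 by blast
    then obtain N where N: "N \<in> \<N>" "(pt x0 \<in> N) \<noteq> (pt y \<in> N)" using Suc.prems(4)[OF x0] by metis
    then have "N \<in> \<N>'" using x0 \<open>y \<in> D\<close> unfolding \<N>'_def by blast
    moreover have "finite \<N>'" using assms(2) by (simp add: \<N>'_def)
    ultimately obtain N1 where N1: "N1 \<in> \<N>'" and min: "\<And>N. N \<in> \<N>' \<Longrightarrow> N \<subseteq> N1 \<Longrightarrow> N = N1"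
      using finite_has_minimal[of \<N>'] by blast
    obtain x where x: "x \<in> D" "pt x \<in> N1" using N1 unfolding \<N>'_def by blast
    have N1in: "N1 \<in> \<N>" using N1 unfolding \<N>'_def by blast
    have other: "pt y \<notin> N1" if y: "y \<in> D - {x}" for y
    proof
      assume y1: "pt y \<in> N1"
      obtain N where N: "N \<in> \<N>" "(pt x \<in> N) \<noteq> (pt y \<in> N)" using Suc.prems(4)[OF x(1)] y by blast
      then have "N \<in> \<N>'" using x y unfolding \<N>'_def by blast
      moreover have "N \<subseteq> N1" using assms(5)[OF N(1) N1in] N(2) x(2) y1 by blast
      ultimately show False using min N(2) x(2) y1 by blast
    qed
    have N0N1: "N0 \<subseteq> N1" using assms(5)[OF Suc.prems(2) N1in] Suc.prems(5)[OF x(1)] x(2) by blast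
    have "n = card (D - {x})" using Suc.hyps(2) Suc.prems(1) x(1) by simp
    then obtain xs where xs: "set xs = D - {x}" "distinct xs"
      "\<forall>G\<in>N1. null (length xs) G \<longrightarrow> xs \<notin> G"
      using Suc.hyps(1)[of "D - {x}" N1, OF _ _ N1in] Suc.prems(1,3,4) other by auto
    have "x # xs \<notin> G" if G: "G \<in> N0" "null (Suc (length xs)) G" for G
    proof -
      have "avoids x N0" using Suc.prems(3)[OF x(1) Suc.prems(2)] Suc.prems(5)[OF x(1)] by blast
      then have "null (length xs) (sec G x)"
        using avoids_null_section assms(4) Suc.prems(2) G by blast
      moreover have "sec G x \<in> N1" using model_sec[OF assms(4)[OF N1in]] N0N1 G x(2) by blast
      ultimately show ?thesis using xs(3) by (auto simp: sec_def)
    qed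
    then show ?thesis using xs x by (intro exI[of _ "x # xs"]) auto
  qed
qed

end


section \<open>Finite cliques with models as side conditions\<close>

type_synonym 'c condition = "'c set \<times> 'c list set set set"

locale clique_forcing = sigma_ideal I for I :: "'b set set" +
  fixes R :: "'b \<Rightarrow> 'b \<Rightarrow> bool"
  assumes R_sym: "R x y \<Longrightarrow> R y x"
    and amalgamation: "F \<subseteq> {xs. length xs = n \<and> distinct xs \<and> pairwise R (set xs)} \<Longrightarrow>
      \<exists>F0\<subseteq>F. countable F0 \<and> null n {ys \<in> F. \<forall>xs\<in>F0. \<not> (\<forall>x\<in>set xs. \<forall>y\<in>set ys. R x y)}"
begin

text \<open>Through \<open>code\<close> the side conditions form a chain under membership. The last
  two clauses make every point generic over each model that omits it and put a model between any two
  points, which is what \<open>avoids_enumeration\<close> asks for.\<close>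

definition conds :: "'b condition set" where
  "conds = {p. finite (fst p) \<and> pairwise R (fst p) \<and> finite (snd p) \<and> (\<forall>N\<in>snd p. model N) \<and>
     (\<forall>N\<in>snd p. \<forall>N'\<in>snd p. N = N' \<or> code N \<in> N' \<or> code N' \<in> N) \<and>
     (\<forall>x\<in>fst p. \<forall>N\<in>snd p. pt x \<in> N \<or> avoids x N) \<and>
     (\<forall>x\<in>fst p. \<forall>y\<in>fst p. x \<noteq> y \<longrightarrow> (\<exists>N\<in>snd p. (pt x \<in> N) \<noteq> (pt y \<in> N)))}"

definition ext :: "'b condition \<Rightarrow> 'b condition \<Rightarrow> bool" where
  "ext p q \<longleftrightarrow> fst q \<subseteq> fst p \<and> snd q \<subseteq> snd p"

lemma condsI:
  assumes "finite D" "pairwise R D" "finite \<N>" "\<And>N. N \<in> \<N> \<Longrightarrow> model N"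
    "\<And>N N'. N \<in> \<N> \<Longrightarrow> N' \<in> \<N> \<Longrightarrow> N = N' \<or> code N \<in> N' \<or> code N' \<in> N"
    "\<And>x N. x \<in> D \<Longrightarrow> N \<in> \<N> \<Longrightarrow> pt x \<in> N \<or> avoids x N"
    "\<And>x y. x \<in> D \<Longrightarrow> y \<in> D \<Longrightarrow> x \<noteq> y \<Longrightarrow> \<exists>N\<in>\<N>. (pt x \<in> N) \<noteq> (pt y \<in> N)"
  shows "(D, \<N>) \<in> conds"
  using assms unfolding conds_def by simp

lemma condsD:
  assumes "p \<in> conds"
  shows "finite (fst p)" "pairwise R (fst p)" "finite (snd p)" "\<And>N. N \<in> snd p \<Longrightarrow> model N"
    "\<And>N N'. N \<in> snd p \<Longrightarrow> N' \<in> snd p \<Longrightarrow> N = N' \<or> code N \<in> N' \<or> code N' \<in> N"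
    "\<And>x N. x \<in> fst p \<Longrightarrow> N \<in> snd p \<Longrightarrow> pt x \<in> N \<or> avoids x N"
    "\<And>x y. x \<in> fst p \<Longrightarrow> y \<in> fst p \<Longrightarrow> x \<noteq> y \<Longrightarrow> \<exists>N\<in>snd p. (pt x \<in> N) \<noteq> (pt y \<in> N)"
  using assms unfolding conds_def mem_Collect_eq by simp_all

lemma ext_refl: "ext p p" and ext_trans: "ext p q \<Longrightarrow> ext q r \<Longrightarrow> ext p r"
  by (auto simp: ext_def)

text \<open>All of \<open>p\<close> lies inside \<open>N\<close>, so \<open>N\<close> goes on top of
  the chain. This extension is the one that turns out to be generic.\<close>

lemma insert_model_conds:
  assumes p: "p \<in> conds" and N: "model N" "\<And>x. x \<in> fst p \<Longrightarrow> pt x \<in> N"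
    "\<And>N'. N' \<in> snd p \<Longrightarrow> code N' \<in> N"
  shows "(fst p, insert N (snd p)) \<in> conds"
proof (rule condsI)
  show "\<exists>N'\<in>insert N (snd p). (pt x \<in> N') \<noteq> (pt y \<in> N')" if "x \<in> fst p" "y \<in> fst p" "x \<noteq> y" for x y
    using condsD(7)[OF p that] by blast
  show "pt x \<in> N' \<or> avoids x N'" if "x \<in> fst p" "N' \<in> insert N (snd p)" for x N'
    using condsD(6)[OF p that(1)] N(2)[OF that(1)] that(2) by blast
  show "N1 = N2 \<or> code N1 \<in> N2 \<or> code N2 \<in> N1" if "N1 \<in> insert N (snd p)" "N2 \<in> insert N (snd p)" for N1 N2
    using condsD(5)[OF p] N(3) that by blast
qed (use condsD[OF p] N in auto)

text \<open>A model of \<open>r\<close> either belongs to \<open>r'\<close> or includes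
  \<open>N\<close>, while \<open>r'\<close> lies inside \<open>N\<close>; so the two chains fit
  together. The model \<open>N\<close> separates the points of \<open>r'\<close> from those of
  \<open>r\<close> outside \<open>N\<close>, and the latter avoid the models of \<open>r'\<close>
  because these are subsets of \<open>N\<close>. Only the edges between the two sides have to be
  assumed, in \<open>cross\<close>.\<close>

lemma amalgam_conds:
  assumes r: "r \<in> conds" "N \<in> snd r" and r': "r' \<in> conds"
    and below: "\<And>x. x \<in> fst r' \<Longrightarrow> pt x \<in> N" "\<And>N'. N' \<in> snd r' \<Longrightarrow> code N' \<in> N"
    and trace: "\<And>x. x \<in> fst r \<Longrightarrow> pt x \<in> N \<Longrightarrow> x \<in> fst r'"
      "\<And>N'. N' \<in> snd r \<Longrightarrow> code N' \<in> N \<Longrightarrow> N' \<in> snd r'"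
    and cross: "\<And>x y. x \<in> fst r' \<Longrightarrow> y \<in> fst r \<Longrightarrow> pt y \<notin> N \<Longrightarrow> R x y"
  shows "(fst r \<union> fst r', snd r \<union> snd r') \<in> conds"
proof -
  have mN: "model N" using condsD(4)[OF r(1)] r(2) by blast
  have sub': "N' \<subseteq> N" if "N' \<in> snd r'" for N'
    using model_code[OF mN condsD(4)[OF r' that] below(2)[OF that]] .
  have above: "N' \<in> snd r' \<or> N \<subseteq> N'" if N': "N' \<in> snd r" for N'
    using condsD(5)[OF r(1) r(2) N'] trace(2)[OF N'] model_code[OF condsD(4)[OF r(1) N'] mN] by blast
  show ?thesis
  proof (rule condsI)
    have "R x y" if xy: "x \<in> fst r \<union> fst r'" "y \<in> fst r \<union> fst r'" "x \<noteq> y" for x y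
    proof -
      consider "x \<in> fst r'" "y \<in> fst r'" | "x \<in> fst r'" "y \<in> fst r" "pt y \<notin> N"
        | "y \<in> fst r'" "x \<in> fst r" "pt x \<notin> N" | "x \<in> fst r" "y \<in> fst r"
        using xy(1,2) trace(1) by blast
      then show ?thesis
        using pairwiseD[OF condsD(2)[OF r(1)]] pairwiseD[OF condsD(2)[OF r']] cross R_sym xy(3)
        by cases blast+
    qed
    then show "pairwise R (fst r \<union> fst r')" by (simp add: pairwise_def)
    show "N1 = N2 \<or> code N1 \<in> N2 \<or> code N2 \<in> N1"
      if "N1 \<in> snd r \<union> snd r'" "N2 \<in> snd r \<union> snd r'" for N1 N2
    proof -
      note Nin = that
      have *: "A = B \<or> code A \<in> B \<or> code B \<in> A" if "A \<in> snd r'" "B \<in> snd r" for A B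
        using above[OF that(2)] condsD(5)[OF r' that(1)] below(2)[OF that(1)] by blast
      consider "N1 \<in> snd r" "N2 \<in> snd r" | "N1 \<in> snd r" "N2 \<in> snd r'"
        | "N1 \<in> snd r'" "N2 \<in> snd r" | "N1 \<in> snd r'" "N2 \<in> snd r'"
        using Nin by (elim UnE)
      then show ?thesis
      proof cases
        case 1 then show ?thesis by (rule condsD(5)[OF r(1)])
      next
        case 2 then show ?thesis using *[of N2 N1] by auto
      next
        case 3 then show ?thesis by (rule *)
      next
        case 4 then show ?thesis by (rule condsD(5)[OF r'])
      qed
    qed
    show "pt x \<in> A \<or> avoids x A" if x: "x \<in> fst r \<union> fst r'" and A: "A \<in> snd r \<union> snd r'" for x A
    proof (cases "x \<in> fst r'")
      case True
      then show ?thesis using A above[of A] below(1)[OF True] condsD(6)[OF r' True] by blast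
    next
      case False
      then have xr: "x \<in> fst r" and xN: "pt x \<notin> N" using x trace(1) by blast+
      then have "avoids x N" using condsD(6)[OF r(1) xr r(2)] by blast
      then show ?thesis using A condsD(6)[OF r(1) xr] sub'[of A] by (auto simp: avoids_def)
    qed
    show "\<exists>A\<in>snd r \<union> snd r'. (pt x \<in> A) \<noteq> (pt y \<in> A)"
      if "x \<in> fst r \<union> fst r'" "y \<in> fst r \<union> fst r'" "x \<noteq> y" for x y
    proof (cases "(pt x \<in> N) = (pt y \<in> N)")
      case True
      then have "x \<in> fst r' \<and> y \<in> fst r' \<or> x \<in> fst r \<and> y \<in> fst r" using that trace(1) below(1) by blast
      then show ?thesis using condsD(7)[OF r(1)] condsD(7)[OF r'] that(3) by (metis UnCI)
    qed (use r(2) in blast)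
  qed (use condsD(1,3,4)[OF r(1)] condsD(1,3,4)[OF r'] in auto)
qed

lemma cond_enumeration:
  assumes r: "r \<in> conds" "N \<in> snd r"
  shows "\<exists>ys. set ys = {x \<in> fst r. pt x \<notin> N} \<and> distinct ys \<and> (\<forall>G\<in>N. null (length ys) G \<longrightarrow> ys \<notin> G)"
proof (rule avoids_enumeration[where \<N> = "snd r"])
  show "N1 \<subseteq> N2 \<or> N2 \<subseteq> N1" if "N1 \<in> snd r" "N2 \<in> snd r" for N1 N2
    using condsD(5)[OF r(1) that] model_code condsD(4)[OF r(1)] that by blast
  show "pt x \<in> N' \<or> avoids x N'" if "x \<in> {x \<in> fst r. pt x \<notin> N}" "N' \<in> snd r" for x N'
    using condsD(6)[OF r(1)] that by blast
  show "\<exists>N\<in>snd r. (pt x \<in> N) \<noteq> (pt y \<in> N)"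
    if "x \<in> {x \<in> fst r. pt x \<notin> N}" "y \<in> {x \<in> fst r. pt x \<notin> N}" "x \<noteq> y" for x y
    using condsD(7)[OF r(1)] that by blast
qed (use condsD(1,3,4)[OF r(1)] r(2) in auto)

section \<open>Generic conditions and properness\<close>

definition copies :: "'b condition set \<Rightarrow> 'b set \<Rightarrow> 'b list set set set \<Rightarrow> nat \<Rightarrow> 'b list set" where
  "copies \<D> D0 \<N>0 n = {xs. length xs = n \<and> distinct xs \<and>
     (\<exists>r\<in>\<D>. r \<in> conds \<and> fst r = D0 \<union> set xs \<and> \<N>0 \<subseteq> snd r)}"

text \<open>A countable closed set \<open>K\<close> is split in two: its sets of lists form
  \<open>N\<close>, its conditions and sets of conditions from \<open>P\<close> form the trace
  \<open>M\<close>. One \<open>N\<close> therefore serves all \<open>p\<close> in \<open>M\<close>.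
  The parameter \<open>h\<close> attaches a set to each condition that \<open>N\<close> has to
  contain, and later carries the bounds \<open>B w\<close> into the model. In \<open>copies\<close>,
  \<open>D0\<close> and \<open>\<N>0\<close> stand for the part of a condition inside
  \<open>N\<close>, and the tuples are candidates for replacing the part outside.\<close>

lemma generic_models:
  fixes h :: "'b condition \<Rightarrow> 'b list set"
  assumes P: "P = {p \<in> conds. ext p q}"
  shows "\<exists>C. club_countable (Inl ` P \<union> Inr ` Pow P) C \<and>
    (\<forall>M\<in>C. \<exists>N. model N \<and>
      (\<forall>p. Inl p \<in> M \<longrightarrow> h p \<in> N \<and> generic_condition P ext M (fst p, insert N (snd p))))"
proof -
  let ?bad = "\<lambda>n F F0. {ys \<in> F. \<forall>xs\<in>F0. \<not> (\<forall>x\<in>set xs. \<forall>y\<in>set ys. R x y)}"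
  have ex_base: "\<exists>F0. F0 \<subseteq> copies \<D> D0 \<N>0 n \<and> countable F0 \<and> null n (?bad n (copies \<D> D0 \<N>0 n) F0)" for \<D> D0 \<N>0 n
  proof -
    have "copies \<D> D0 \<N>0 n \<subseteq> {xs. length xs = n \<and> distinct xs \<and> pairwise R (set xs)}"
    proof (clarsimp simp: copies_def)
      fix xs \<N> assume "(D0 \<union> set xs, \<N>) \<in> conds"
      then show "pairwise R (set xs)" using condsD(2) pairwise_subset by fastforce
    qed
    from amalgamation[OF this] show ?thesis by blast
  qed
  define base where "base \<D> D0 \<N>0 n = (SOME F0. F0 \<subseteq> copies \<D> D0 \<N>0 n \<and> countable F0 \<and>
      null n (?bad n (copies \<D> D0 \<N>0 n) F0))" for \<D> D0 \<N>0 n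
  have base: "base \<D> D0 \<N>0 n \<subseteq> copies \<D> D0 \<N>0 n" "countable (base \<D> D0 \<N>0 n)"
      "null n (?bad n (copies \<D> D0 \<N>0 n) (base \<D> D0 \<N>0 n))" for \<D> D0 \<N>0 n
    using someI_ex[OF ex_base[of \<D> D0 \<N>0 n]] unfolding base_def by blast+
  define wit where "wit \<D> D0 \<N>0 xs = (SOME r. r \<in> \<D> \<and> r \<in> conds \<and> fst r = D0 \<union> set xs \<and> \<N>0 \<subseteq> snd r)"
    for \<D> :: "'b condition set" and D0 \<N>0 xs
  have wit: "wit \<D> D0 \<N>0 xs \<in> \<D> \<and> wit \<D> D0 \<N>0 xs \<in> conds \<and>
      fst (wit \<D> D0 \<N>0 xs) = D0 \<union> set xs \<and> \<N>0 \<subseteq> snd (wit \<D> D0 \<N>0 xs)"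
    if "xs \<in> base \<D> D0 \<N>0 n" for \<D> D0 \<N>0 xs n
  proof -
    have "\<exists>r. r \<in> \<D> \<and> r \<in> conds \<and> fst r = D0 \<union> set xs \<and> \<N>0 \<subseteq> snd r"
      using that base(1) unfolding copies_def by blast
    then show ?thesis unfolding wit_def by (rule someI_ex)
  qed
  define cnds where "cnds e = {p \<in> conds. Inr (Inl p) \<in> e}"
    for e :: "('b list set + ('b condition + 'b condition set)) set"
  define dns where "dns e = {\<D>. Inr (Inr \<D>) \<in> e}"
    for e :: "('b list set + ('b condition + 'b condition set)) set"
  define objs where "objs e = {G. Inl G \<in> e}"
    for e :: "('b list set + ('b condition + 'b condition set)) set"
  define pts where "pts e = {x. Inl (pt x) \<in> e}"
    for e :: "('b list set + ('b condition + 'b condition set)) set"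
  define mods where "mods e = {N. countable N \<and> N \<noteq> {} \<and> Inl (code N) \<in> e}"
    for e :: "('b list set + ('b condition + 'b condition set)) set"
  \<comment> \<open>Closing under \<open>op\<close> yields the clauses of \<open>model\<close>, the
    points and models of conditions in \<open>M\<close>, the values of \<open>h\<close>, the
    exceptional null sets, and the conditions realising members of \<open>base\<close>. The finite
    parameters \<open>D0\<close> and \<open>\<N>0\<close> are no elements of \<open>K\<close>; they
    are read off from the finite argument \<open>e\<close>, hence the power sets.
    \<open>Inl {}\<close> makes \<open>N\<close> nonempty.\<close>
  define op where "op e =
      insert (Inl {}) ((\<Union>p\<in>cnds e. Inl ` pt ` fst p) \<union> (\<Union>p\<in>cnds e. Inl ` code ` snd p) \<union>
      (\<Union>N\<in>mods e. Inl ` N) \<union> (\<Union>G\<in>objs e. range (\<lambda>n. Inl (bad n G))) \<union>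
      (\<Union>G\<in>objs e. \<Union>x\<in>pts e. {Inl (sec G x)}) \<union> (\<Union>p\<in>cnds e. {Inl (h p)}) \<union>
      (\<Union>\<D>\<in>dns e. \<Union>D0\<in>Pow (pts e). \<Union>\<N>0\<in>Pow (mods e).
         range (\<lambda>n. Inl (?bad n (copies \<D> D0 \<N>0 n) (base \<D> D0 \<N>0 n)))) \<union>
      (\<Union>\<D>\<in>dns e. \<Union>D0\<in>Pow (pts e). \<Union>\<N>0\<in>Pow (mods e). \<Union>n.
         (\<lambda>xs. Inr (Inl (wit \<D> D0 \<N>0 xs)) :: 'b list set + ('b condition + 'b condition set)) ` base \<D> D0 \<N>0 n))"
    for e :: "('b list set + ('b condition + 'b condition set)) set"
  have opI: "(\<Union>N\<in>mods e. Inl ` N) \<subseteq> op e" "(\<Union>G\<in>objs e. \<Union>x\<in>pts e. {Inl (sec G x)}) \<subseteq> op e"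
      "(\<Union>\<D>\<in>dns e. \<Union>D0\<in>Pow (pts e). \<Union>\<N>0\<in>Pow (mods e).
         range (\<lambda>n. Inl (?bad n (copies \<D> D0 \<N>0 n) (base \<D> D0 \<N>0 n)))) \<subseteq> op e"
      "(\<Union>\<D>\<in>dns e. \<Union>D0\<in>Pow (pts e). \<Union>\<N>0\<in>Pow (mods e). \<Union>n.
         (\<lambda>xs. Inr (Inl (wit \<D> D0 \<N>0 xs))) ` base \<D> D0 \<N>0 n) \<subseteq> op e" for e
    by (rule subsetI, simp only: op_def Un_iff insert_iff simp_thms)+
  have "countable (op e)" if e: "finite e" for e
  proof -
    have "finite ((\<lambda>p. Inr (Inl p)) -` e)" "finite ((\<lambda>p. Inr (Inr p)) -` e)" "finite (Inl -` e)"
      by (intro finite_vimageI e injI, simp)+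
    then have f1: "finite (cnds e)" "finite (dns e)" "finite (objs e)"
      unfolding cnds_def dns_def objs_def by (auto simp: vimage_def)
    have "finite (pt -` objs e)" by (intro finite_vimageI f1 inj_pt)
    then have f2: "finite (pts e)" by (auto simp: vimage_def pts_def objs_def)
    have "finite (code -` objs e \<inter> {N. countable N \<and> N \<noteq> {}})"
      using f1(3) inj_on_code by (rule finite_vimage_IntI)
    moreover have "mods e = code -` objs e \<inter> {N. countable N \<and> N \<noteq> {}}"
      by (auto simp: mods_def objs_def)
    ultimately have f3: "finite (mods e)" by simp
    have c: "countable (fst p)" "countable (snd p)" if "p \<in> cnds e" for p
      using that condsD(1,3)[of p] by (simp_all add: cnds_def countable_finite)
    have cN: "countable N" if "N \<in> mods e" for N using that by (simp add: mods_def)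
    have f4: "finite (Pow (pts e))" "finite (Pow (mods e))" using f2 f3 by auto
    show ?thesis unfolding op_def
      by (intro countable_insert countable_Un countable_UN countable_image countable_finite[OF f1(1)]
          countable_finite[OF f1(2)] countable_finite[OF f1(3)] countable_finite[OF f2]
          countable_finite[OF f3] countable_finite[OF f4(1)] countable_finite[OF f4(2)] c cN base(2)) auto
  qed
  then have "\<exists>C. club_countable (Inl ` P \<union> Inr ` Pow P) C \<and>
      (\<forall>M\<in>C. \<exists>K. countable K \<and> op_closed op K \<and> Inr -` K \<inter> (Inl ` P \<union> Inr ` Pow P) = M)"
    by (rule club_countable_closed_traces)
  then obtain C where C: "club_countable (Inl ` P \<union> Inr ` Pow P) C"
    and CK: "\<forall>M\<in>C. \<exists>K. countable K \<and> op_closed op K \<and> Inr -` K \<inter> (Inl ` P \<union> Inr ` Pow P) = M"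
    by (elim exE conjE)
  have "\<exists>N. model N \<and> (\<forall>p. Inl p \<in> M \<longrightarrow> h p \<in> N \<and> generic_condition P ext M (fst p, insert N (snd p)))"
    if "M \<in> C" for M
  proof -
    obtain K where K: "countable K" "op_closed op K" "Inr -` K \<inter> (Inl ` P \<union> Inr ` Pow P) = M"
      using bspec[OF CK \<open>M \<in> C\<close>] by (elim exE conjE)
    have opK: "z \<in> K" if "finite e" "e \<subseteq> K" "z \<in> op e" for e z
      using K(2) that unfolding op_closed_def by blast
    define N where "N = {G. Inl G \<in> K}"
    have MP: "p \<in> P" "p \<in> conds" "Inr (Inl p) \<in> K" if "Inl p \<in> M" for p
      using that K(3) P by auto
    have ptsN: "pt x \<in> N" if "Inl p \<in> M" "x \<in> fst p" for p x
      using opK[of "{Inr (Inl p)}" "Inl (pt x)"] MP[OF that(1)] that(2)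
      by (auto simp: N_def op_def cnds_def)
    have modsN: "code N' \<in> N" if "Inl p \<in> M" "N' \<in> snd p" for p N'
      using opK[of "{Inr (Inl p)}" "Inl (code N')"] MP[OF that(1)] that(2)
      by (auto simp: N_def op_def cnds_def)
    have hN: "h p \<in> N" if "Inl p \<in> M" for p
      using opK[of "{Inr (Inl p)}" "Inl (h p)"] MP[OF that(1)]
      by (auto simp: N_def op_def cnds_def)
    have "model N" unfolding model_def
    proof (intro conjI allI impI ballI)
      show "countable N"
        using countable_image_inj_Int_vimage[of Inl UNIV K] K(1) by (simp add: N_def vimage_def)
      show "N \<noteq> {}" using opK[of "{}" "Inl {}"] by (auto simp: N_def op_def)
      show "bad n G \<in> N" if "G \<in> N" for G n
        using opK[of "{Inl G}" "Inl (bad n G)"] that by (auto simp: N_def op_def objs_def)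
      show "sec G x \<in> N" if "G \<in> N" "pt x \<in> N" for G x
      proof -
        have "Inl (sec G x) \<in> op {Inl G, Inl (pt x)}"
          by (rule subsetD[OF opI(2)], intro UN_I[of G] UN_I[of x]) (simp_all add: objs_def pts_def)
        then show ?thesis using opK[of "{Inl G, Inl (pt x)}" "Inl (sec G x)"] that by (auto simp: N_def)
      qed
      show "N' \<subseteq> N" if N': "countable N' \<and> N' \<noteq> {} \<and> code N' \<in> N" for N'
      proof
        fix G assume "G \<in> N'"
        then have "Inl G \<in> op {Inl (code N')}" using N'
          by (intro subsetD[OF opI(1)] UN_I[of N']) (simp_all add: mods_def)
        then show "G \<in> N" using opK[of "{Inl (code N')}" "Inl G"] N' by (auto simp: N_def)
      qed
    qed
    moreover have "generic_condition P ext M (fst p, insert N (snd p))" if p: "Inl p \<in> M" for p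
      unfolding generic_condition_def predense_below_def
    proof (intro conjI allI impI)
      have "(fst p, insert N (snd p)) \<in> conds"
        using insert_model_conds[OF MP(2)[OF p] \<open>model N\<close>] ptsN[OF p] modsN[OF p] by blast
      moreover have "ext p q" using MP(1)[OF p] P by blast
      ultimately show "(fst p, insert N (snd p)) \<in> P" unfolding P by (auto simp: ext_def)
    next
      fix \<D> assume \<D>: "Inr \<D> \<in> M \<and> dense_in P ext \<D>"
      show "\<forall>r\<in>P. ext r (fst p, insert N (snd p)) \<longrightarrow> (\<exists>a\<in>{d \<in> \<D>. Inl d \<in> M}. compatible P ext r a)"
      proof (intro ballI impI)
        fix r0 assume r0: "r0 \<in> P" "ext r0 (fst p, insert N (snd p))"
        then obtain r where r: "r \<in> \<D>" "ext r r0" using \<D> unfolding dense_in_def by blast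
        have "\<D> \<subseteq> P" using \<D> unfolding dense_in_def by blast
        then have rP: "r \<in> P" and rc: "r \<in> conds" using r(1) P by auto
        have Nr: "N \<in> snd r" using r(2) r0(2) by (auto simp: ext_def)
        obtain ys where ys: "set ys = {x \<in> fst r. pt x \<notin> N}" "distinct ys"
            "\<forall>G\<in>N. null (length ys) G \<longrightarrow> ys \<notin> G"
          using cond_enumeration[OF rc Nr] by blast
        define n where "n = length ys"
        define D0 where "D0 = {x \<in> fst r. pt x \<in> N}"
        define \<N>0 where "\<N>0 = {N' \<in> snd r. code N' \<in> N}"
        have "fst r = D0 \<union> set ys" using ys(1) by (auto simp: D0_def)
        then have ysF: "ys \<in> copies \<D> D0 \<N>0 n"
          using ys(2) r(1) rc by (auto simp: copies_def n_def \<N>0_def)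
        \<comment> \<open>Finitely many elements of \<open>K\<close> from which \<open>op\<close>
          recovers the parameters \<D>, \<open>D0\<close> and \<open>\<N>0\<close>.\<close>
        define e :: "('b list set + ('b condition + 'b condition set)) set" where "e = insert (Inr (Inr \<D>)) ((\<lambda>x. Inl (pt x)) ` D0 \<union> (\<lambda>N. Inl (code N)) ` \<N>0)"
        have \<D>K: "Inr (Inr \<D>) \<in> K" using \<D> K(3) by auto
        have e: "finite e" "e \<subseteq> K"
          using condsD(1,3)[OF rc] \<D>K by (auto simp: e_def D0_def \<N>0_def N_def)
        have in_e: "\<D> \<in> dns e" "D0 \<in> Pow (pts e)" "\<N>0 \<in> Pow (mods e)"
        proof -
          have "countable N' \<and> N' \<noteq> {}" if "N' \<in> snd r" for N'
            using condsD(4)[OF rc that] by (auto simp: model_def)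
          then show "\<N>0 \<in> Pow (mods e)" by (auto simp: e_def mods_def \<N>0_def)
        qed (auto simp: e_def dns_def pts_def)
        have "Inl (?bad n (copies \<D> D0 \<N>0 n) (base \<D> D0 \<N>0 n)) \<in> op e"
          by (rule subsetD[OF opI(3)], rule UN_I[OF in_e(1)], rule UN_I[OF in_e(2)],
              rule UN_I[OF in_e(3)], rule range_eqI[of _ _ n], rule refl)
        then have "?bad n (copies \<D> D0 \<N>0 n) (base \<D> D0 \<N>0 n) \<in> N"
          using opK[OF e] by (simp add: N_def)
        \<comment> \<open>The tuple \<open>ys\<close> escapes every null set in \<open>N\<close>, in
          particular the exceptional one, so some tuple of the countable \<open>base\<close> is
          joined to it.\<close>
        then have "ys \<notin> ?bad n (copies \<D> D0 \<N>0 n) (base \<D> D0 \<N>0 n)"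
          using ys(3) base(3) n_def by blast
        then obtain xs where xs: "xs \<in> base \<D> D0 \<N>0 n" "\<forall>x\<in>set xs. \<forall>y\<in>set ys. R x y"
          using ysF by blast
        define r' where "r' = wit \<D> D0 \<N>0 xs"
        have r': "r' \<in> \<D>" "r' \<in> conds" "fst r' = D0 \<union> set xs" "\<N>0 \<subseteq> snd r'"
          using wit[OF xs(1)] by (auto simp: r'_def)
        have "Inr (Inl r') \<in> op e"
          unfolding r'_def
          by (rule subsetD[OF opI(4)], rule UN_I[OF in_e(1)], rule UN_I[OF in_e(2)],
              rule UN_I[OF in_e(3)], rule UN_I[of n, OF UNIV_I], rule image_eqI[OF refl xs(1)])
        then have "Inr (Inl r') \<in> K" using opK[OF e] by blast
        then have r'M: "Inl r' \<in> M" using K(3) r'(1) \<open>\<D> \<subseteq> P\<close> by auto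
        define s where "s = (fst r \<union> fst r', snd r \<union> snd r')"
        have "s \<in> conds" unfolding s_def
        proof (rule amalgam_conds[OF rc Nr r'(2)])
          show "R x y" if "x \<in> fst r'" "y \<in> fst r" "pt y \<notin> N" for x y
          proof -
            have y: "y \<in> set ys" using that ys(1) by blast
            show ?thesis
            proof (cases "x \<in> set xs")
              case True
              then show ?thesis using xs(2) y by blast
            next
              case False
              then have "x \<in> D0" using that(1) r'(3) by blast
              then have "x \<in> fst r" "x \<noteq> y" using that(3) by (auto simp: D0_def)
              then show ?thesis using pairwiseD[OF condsD(2)[OF rc]] that(2) by blast
            qed
          qed
          show "pt x \<in> N" if "x \<in> fst r'" for x by (rule ptsN[OF r'M that])
          show "code N' \<in> N" if "N' \<in> snd r'" for N' by (rule modsN[OF r'M that])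
          show "x \<in> fst r'" if "x \<in> fst r" "pt x \<in> N" for x using that r'(3) by (simp add: D0_def)
          show "N' \<in> snd r'" if "N' \<in> snd r" "code N' \<in> N" for N'
            using that by (intro subsetD[OF r'(4)]) (simp add: \<N>0_def)
        qed
        moreover have "ext s r" "ext s r'" by (auto simp: s_def ext_def)
        moreover have "ext r q" using rP P by blast
        ultimately have "s \<in> P" "ext s r0" "ext s r'" using P r(2) ext_trans by blast+
        then show "\<exists>a\<in>{d \<in> \<D>. Inl d \<in> M}. compatible P ext r0 a"
          using r'(1) r'M unfolding compatible_def by blast
      qed
    qed
    ultimately show ?thesis using hN by blast
  qed
  then show ?thesis using C by blast
qed

lemma proper_conds:
  assumes "q \<in> conds"
  shows "proper_forcing {p \<in> conds. ext p q} ext"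
  unfolding proper_forcing_def
proof (intro conjI)
  show "forcing_notion {p \<in> conds. ext p q} ext"
    unfolding forcing_notion_def
  proof (intro conjI)
    show "{p \<in> conds. ext p q} \<noteq> {}" using assms ext_refl by blast
    show "reflp_on {p \<in> conds. ext p q} ext" using ext_refl by (rule reflp_onI)
    show "transp_on {p \<in> conds. ext p q} ext" using ext_trans by (rule transp_onI)
  qed
  obtain C where C: "club_countable (Inl ` {p \<in> conds. ext p q} \<union> Inr ` Pow {p \<in> conds. ext p q}) C"
    "\<forall>M\<in>C. \<exists>N. model N \<and> (\<forall>p. Inl p \<in> M \<longrightarrow> {} \<in> N \<and>
      generic_condition {p \<in> conds. ext p q} ext M (fst p, insert N (snd p)))"
    using generic_models[OF refl, of q "\<lambda>_. {}"] by blast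
  have "\<exists>r. ext r p \<and> generic_condition {p \<in> conds. ext p q} ext M r" if M: "M \<in> C" "Inl p \<in> M" for M p
  proof -
    obtain N where "\<forall>p. Inl p \<in> M \<longrightarrow> {} \<in> N \<and>
        generic_condition {p \<in> conds. ext p q} ext M (fst p, insert N (snd p))"
      using bspec[OF C(2) M(1)] by (elim exE conjE)
    then have "generic_condition {p \<in> conds. ext p q} ext M (fst p, insert N (snd p))"
      using M(2) by simp
    moreover have "ext (fst p, insert N (snd p)) p" by (auto simp: ext_def)
    ultimately show ?thesis by blast
  qed
  then show "\<exists>C. club_countable (Inl ` {p \<in> conds. ext p q} \<union> Inr ` Pow {p \<in> conds. ext p q}) C \<and>
      (\<forall>M\<in>C. \<forall>p. Inl p \<in> M \<longrightarrow> (\<exists>r. ext r p \<and> generic_condition {p \<in> conds. ext p q} ext M r))"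
    using C(1) by blast
qed

text \<open>Otherwise the conditions \<D> that confine the clique to some \<open>B w\<close> are
  dense. Let \<open>M\<close> contain \<D> and the empty condition, let \<open>N\<close> be its
  model and let \<open>x\<close> avoid \<open>N\<close>. By genericity \<open>({x}, {N})\<close> is
  compatible with some \<open>a\<close> in \<D> and \<open>M\<close>, which puts \<open>x\<close>
  into the small set \<open>B (wr a)\<close>; but \<open>N\<close> contains this set through
  \<open>h\<close>.\<close>

lemma ex_unbounded_condition:
  assumes "\<And>w. w \<in> W \<Longrightarrow> B w \<in> I"
  shows "\<exists>q\<in>conds. \<forall>r\<in>conds. ext r q \<longrightarrow> (\<forall>w\<in>W. \<exists>s\<in>conds. ext s r \<and> \<not> fst s \<subseteq> B w)"
proof (rule ccontr)
  define \<D> where "\<D> = {r \<in> conds. \<exists>w\<in>W. \<forall>s\<in>conds. ext s r \<longrightarrow> fst s \<subseteq> B w}"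
  define wr where "wr r = (SOME w. w \<in> W \<and> (\<forall>s\<in>conds. ext s r \<longrightarrow> fst s \<subseteq> B w))" for r
  have wr: "wr r \<in> W \<and> (\<forall>s\<in>conds. ext s r \<longrightarrow> fst s \<subseteq> B (wr r))" if "r \<in> \<D>" for r
    unfolding wr_def by (rule someI_ex) (use that in \<open>auto simp: \<D>_def\<close>)
  assume "\<not> ?thesis"
  then have dense: "\<exists>d\<in>\<D>. ext d p" if "p \<in> conds" for p
    using that unfolding \<D>_def by blast
  define p0 where "p0 = ({} :: 'b set, {} :: 'b list set set set)"
  have p0: "p0 \<in> conds" unfolding p0_def by (rule condsI) auto
  define P where "P = {p \<in> conds. ext p p0}"
  have Pc: "P = conds" by (auto simp: P_def p0_def ext_def)
  obtain C where C: "club_countable (Inl ` P \<union> Inr ` Pow P) C"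
    "\<forall>M\<in>C. \<exists>N. model N \<and> (\<forall>p. Inl p \<in> M \<longrightarrow> (\<lambda>x. [x]) ` B (wr p) \<in> N \<and>
      generic_condition P ext M (fst p, insert N (snd p)))"
    using generic_models[OF P_def, of "\<lambda>p. (\<lambda>x. [x]) ` B (wr p)"] by blast
  have "\<D> \<subseteq> P" unfolding Pc by (auto simp: \<D>_def)
  then have "{Inl p0, Inr \<D>} \<subseteq> Inl ` P \<union> Inr ` Pow P" "countable {Inl p0, Inr \<D>}" using p0 Pc by auto
  then obtain M where M: "M \<in> C" "{Inl p0, Inr \<D>} \<subseteq> M" using club_countable_cofinal[OF C(1)] by blast
  obtain N where N: "model N" "\<forall>p. Inl p \<in> M \<longrightarrow> (\<lambda>x. [x]) ` B (wr p) \<in> N \<and>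
      generic_condition P ext M (fst p, insert N (snd p))"
    using bspec[OF C(2) M(1)] by (elim exE conjE)
  have "Inl p0 \<in> M" using M(2) by simp
  from N(2)[THEN spec, THEN mp, OF this] have gen: "generic_condition P ext M ({}, {N})"
    unfolding p0_def fst_conv snd_conv by (rule conjunct2)
  have "countable N" using N(1) by (simp add: model_def)
  then obtain x where x: "avoids x N" using ex_avoids by blast
  have "({x}, {N}) \<in> P" unfolding Pc using x N(1) by (intro condsI) auto
  moreover have "ext ({x}, {N}) ({}, {N})" by (simp add: ext_def)
  moreover have "dense_in P ext \<D>" using dense \<open>\<D> \<subseteq> P\<close> unfolding dense_in_def Pc by blast
  ultimately obtain a where a: "a \<in> \<D>" "Inl a \<in> M" "compatible P ext ({x}, {N}) a"
  proof -
    have "Inr \<D> \<in> M" using M(2) by simp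
    then have "Inr \<D> \<in> M \<and> dense_in P ext \<D>" using \<open>dense_in P ext \<D>\<close> by (rule conjI)
    then have "predense_below P ext {d \<in> \<D>. Inl d \<in> M} ({}, {N})"
      by (rule gen[unfolded generic_condition_def, THEN conjunct2, THEN spec, THEN mp])
    then show ?thesis
      using that \<open>({x}, {N}) \<in> P\<close> \<open>ext ({x}, {N}) ({}, {N})\<close> unfolding predense_below_def by blast
  qed
  then obtain s where s: "s \<in> conds" "ext s ({x}, {N})" "ext s a" unfolding compatible_def Pc by blast
  then have "x \<in> B (wr a)" using wr[OF a(1)] by (auto simp: ext_def)
  moreover have "null (Suc 0) ((\<lambda>x. [x]) ` B (wr a))"
    using wr[OF a(1)] assms by (simp add: null_1 image_iff del: null.simps)
  ultimately show False using x N(2) a(2) unfolding avoids_def by blast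
qed

text \<open>Below \<open>q\<close> the conditions whose clique leaves \<open>B w\<close> are dense,
  for each \<open>w\<close>. The union of the cliques of a filter meeting them is a clique, as any
  two of its points occur together in one condition.\<close>

theorem PFA_unbounded_clique:
  assumes pfa: "PFA TYPE('b set \<times> 'b list set set set)"
    and W: "|W| \<le>o omega1" and B: "\<And>w. w \<in> W \<Longrightarrow> B w \<in> I"
  shows "\<exists>Y. pairwise R Y \<and> (\<forall>w\<in>W. \<not> Y \<subseteq> B w)"
proof -
  obtain q where q: "q \<in> conds"
    "\<And>r w. r \<in> conds \<Longrightarrow> ext r q \<Longrightarrow> w \<in> W \<Longrightarrow> \<exists>s\<in>conds. ext s r \<and> \<not> fst s \<subseteq> B w"
    using ex_unbounded_condition[of W B, OF B] by blast
  define P where "P = {p \<in> conds. ext p q}"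
  define E where "E w = {p \<in> P. \<not> fst p \<subseteq> B w}" for w
  have "proper_forcing P ext" using proper_conds[OF q(1)] by (simp add: P_def)
  moreover have "dense_in P ext D" if "D \<in> E ` W" for D
  proof -
    obtain w where w: "w \<in> W" "D = E w" using \<open>D \<in> E ` W\<close> by blast
    have "\<exists>d\<in>E w. ext d p" if p: "p \<in> P" for p
    proof -
      obtain s where "s \<in> conds" "ext s p" "\<not> fst s \<subseteq> B w" using q(2) p w(1) unfolding P_def by blast
      then show ?thesis using ext_trans p unfolding E_def P_def by blast
    qed
    then show ?thesis unfolding dense_in_def w(2) by (auto simp: E_def)
  qed
  moreover have "|E ` W| \<le>o omega1" using W card_of_image ordLeq_transitive by blast
  ultimately obtain G where G: "filter_in P ext G" "\<forall>D\<in>E ` W. G \<inter> D \<noteq> {}"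
    using pfa unfolding PFA_def by meson
  have GP: "G \<subseteq> conds" using G(1) unfolding filter_in_def P_def by auto
  have dir: "\<exists>r\<in>G. ext r p \<and> ext r q" if "p \<in> G" "q \<in> G" for p q
    using G(1) that unfolding filter_in_def by simp
  define Y where "Y = \<Union>(fst ` G)"
  have "pairwise R Y"
  proof (rule pairwiseI)
    fix x y assume "x \<in> Y" "y \<in> Y" "x \<noteq> y"
    then obtain p p' where pp': "p \<in> G" "p' \<in> G" "x \<in> fst p" "y \<in> fst p'" unfolding Y_def by blast
    then obtain r where "r \<in> G" "ext r p" "ext r p'" using dir by blast
    then have "x \<in> fst r" "y \<in> fst r" "r \<in> conds" using pp' GP by (auto simp: ext_def)
    then show "R x y" using condsD(2) \<open>x \<noteq> y\<close> by (blast dest: pairwiseD)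
  qed
  moreover have "\<not> Y \<subseteq> B w" if "w \<in> W" for w
  proof -
    have "G \<inter> E w \<noteq> {}" using bspec[OF G(2) imageI[OF that]] .
    then obtain p where "p \<in> G" "p \<in> E w" by blast
    then show ?thesis unfolding E_def Y_def by blast
  qed
  ultimately show ?thesis by blast
qed

end


section \<open>Spaces of countable spread are hereditarily Lindelof\<close>

text \<open>Indexed form of countable spread: the isolating open sets also make \<open>y\<close>
  injective, so countability passes from the points to the indices.\<close>

lemma countable_spread_isolated_family:
  assumes spread: "countable_spread Y"
    and top: "\<And>w. w \<in> A \<Longrightarrow> y w \<in> topspace Y"
    and iso: "\<And>w. w \<in> A \<Longrightarrow> \<exists>T. openin Y T \<and> y w \<in> T \<and> (\<forall>v\<in>A. v \<noteq> w \<longrightarrow> y v \<notin> T)"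
  shows "countable A"
proof -
  have inj: "inj_on y A"
  proof (rule inj_onI, rule ccontr)
    fix v w assume vw: "v \<in> A" "w \<in> A" "y v = y w" "v \<noteq> w"
    obtain T where "y w \<in> T" "\<forall>v\<in>A. v \<noteq> w \<longrightarrow> y v \<notin> T" using iso[OF vw(2)] by blast
    then show False using vw by auto
  qed
  have "openin (subtopology Y (y ` A)) {y w}" if w: "w \<in> A" for w
  proof -
    obtain T where T: "openin Y T" "y w \<in> T" "\<forall>v\<in>A. v \<noteq> w \<longrightarrow> y v \<notin> T" using iso[OF w] by blast
    then have "{y w} = T \<inter> y ` A" using w by auto
    then show ?thesis using T(1) unfolding openin_subtopology by blast
  qed
  moreover have "topspace (subtopology Y (y ` A)) = y ` A" using top by auto
  ultimately have "discrete_topology (y ` A) = subtopology Y (y ` A)"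
    unfolding discrete_topology_unique by blast
  then have "countable (y ` A)" using spread top unfolding countable_spread_def by (metis image_subsetI)
  then show ?thesis using inj by (rule countable_image_inj_on)
qed

text \<open>The set \<open>V v\<close> misses all later points. The closed \<open>C w\<close> comes
  from regularity; removing finitely many of them from an open set leaves it open and deletes all
  points of the corresponding \<open>U w\<close>.\<close>

locale right_separated =
  fixes Y :: "'x topology" and y :: "nat set \<Rightarrow> 'x" and U V C :: "nat set \<Rightarrow> 'x set"
  assumes spread: "countable_spread Y"
    and openU: "w \<in> Field omega1 \<Longrightarrow> openin Y (U w)"
    and closedC: "w \<in> Field omega1 \<Longrightarrow> closedin Y (C w)"
    and y_U: "w \<in> Field omega1 \<Longrightarrow> y w \<in> U w"
    and U_C: "w \<in> Field omega1 \<Longrightarrow> U w \<subseteq> C w"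
    and C_V: "w \<in> Field omega1 \<Longrightarrow> C w \<subseteq> V w"
    and separated: "(v, w) \<in> omega1 - Id \<Longrightarrow> y w \<notin> V v"
begin

lemma omega1_Field: "(v, w) \<in> omega1 \<Longrightarrow> v \<in> Field omega1" "(v, w) \<in> omega1 \<Longrightarrow> w \<in> Field omega1"
  by (auto simp: Field_def)

lemma y_topspace: "w \<in> Field omega1 \<Longrightarrow> y w \<in> topspace Y"
  using openU y_U openin_subset by blast

text \<open>Suppose that for every countable \<open>B\<close> in \<open>A\<close> the points of
  \<open>B\<close> are covered by finitely many sets \<open>U e\<close> with \<open>e\<close> in
  \<open>E B\<close>. Choose \<open>a w\<close> in \<open>A\<close> recursively above all earlier
  choices \<open>B\<close> and above \<open>E B\<close>. Then \<open>U (a w)\<close> minus the sets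
  \<open>C e\<close> isolates \<open>y (a w)\<close>: earlier points lie in some \<open>C e\<close>,
  later ones are outside \<open>V (a w)\<close>, and \<open>a w\<close> is beyond every
  \<open>e\<close>. This contradicts countable spread.\<close>

lemma escape_finite_unions:
  assumes A: "A \<subseteq> Field omega1" "uncountable A"
  shows "\<exists>B\<subseteq>A. countable B \<and> (\<forall>E. finite E \<and> E \<subseteq> Field omega1 \<longrightarrow> (\<exists>b\<in>B. \<forall>e\<in>E. y b \<notin> U e))"
proof (rule ccontr)
  assume neg: "\<not> ?thesis"
  define E where "E B = (SOME E. finite E \<and> E \<subseteq> Field omega1 \<and> y ` B \<subseteq> \<Union>(U ` E))" for B
  have E: "finite (E B) \<and> E B \<subseteq> Field omega1 \<and> y ` B \<subseteq> \<Union>(U ` E B)" if "B \<subseteq> A" "countable B" for B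
  proof -
    have "\<not> (\<forall>E. finite E \<and> E \<subseteq> Field omega1 \<longrightarrow> (\<exists>b\<in>B. \<forall>e\<in>E. y b \<notin> U e))"
      using neg that by (simp only: not_ex de_Morgan_conj) blast
    then obtain E where "\<not> (finite E \<and> E \<subseteq> Field omega1 \<longrightarrow> (\<exists>b\<in>B. \<forall>e\<in>E. y b \<notin> U e))"
      unfolding not_all by (elim exE)
    then have E: "finite E" "E \<subseteq> Field omega1" "\<forall>b\<in>B. \<exists>e\<in>E. y b \<in> U e" by simp_all
    then have "y ` B \<subseteq> \<Union>(U ` E)" by blast
    then have "\<exists>E. finite E \<and> E \<subseteq> Field omega1 \<and> y ` B \<subseteq> \<Union>(U ` E)" using E(1,2) by blast
    then show ?thesis unfolding E_def by (rule someI_ex)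
  qed
  \<comment> \<open>The recursion runs over the whole type, so nothing is asked of values outside
    \<open>Field omega1\<close>.\<close>
  define Q where "Q f w r \<longleftrightarrow> (w \<in> Field omega1 \<longrightarrow> r \<in> A \<and> (\<forall>v. (v, w) \<in> omega1 - Id \<longrightarrow> (f v, r) \<in> omega1 - Id) \<and>
    (\<forall>e\<in>E (f ` {v. (v, w) \<in> omega1 - Id}). (e, r) \<in> omega1 - Id))" for f w r
  have "\<exists>f. \<forall>w. Q f w (f w)"
  proof (rule dependent_wf_choice[OF wf_omega1])
    fix f g :: "nat set \<Rightarrow> nat set" and w r
    assume fg: "\<And>z. (z, w) \<in> omega1 - Id \<Longrightarrow> f z = g z"
    then have "f ` {v. (v, w) \<in> omega1 - Id} = g ` {v. (v, w) \<in> omega1 - Id}" by (intro image_cong) auto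
    then show "Q f w r = Q g w r" using fg unfolding Q_def by simp
  next
    fix w f assume IH: "\<And>v. (v, w) \<in> omega1 - Id \<Longrightarrow> Q f v (f v)"
    show "\<exists>r. Q f w r"
    proof (cases "w \<in> Field omega1")
      case True
      define B where "B = f ` {v. (v, w) \<in> omega1 - Id}"
      have BA: "B \<subseteq> A" using IH omega1_Field unfolding B_def Q_def by blast
      have cB: "countable B" unfolding B_def
        by (intro countable_image countable_subset[OF _ countable_under_omega1[of w]]) auto
      have "countable (B \<union> E B)" using cB E[OF BA cB] by (simp add: countable_finite)
      then obtain w' where w': "w' \<in> Field omega1"
          "(B \<union> E B) \<inter> Field omega1 \<subseteq> {v. (v, w') \<in> omega1 - Id}"
        using countable_bounded_omega1 by blast
      have "\<not> A \<subseteq> {v. (v, w') \<in> omega1}" using A(2) countable_under_omega1 countable_subset by blast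
      then obtain r where r: "r \<in> A" "(r, w') \<notin> omega1" by blast
      then have w'r: "(w', r) \<in> omega1" using A(1) w'(1) total_omega1 by blast
      have lt: "(v, r) \<in> omega1 - Id" if v: "v \<in> B \<union> E B" for v
      proof -
        have "(v, w') \<in> omega1 - Id" using w'(2) v BA A(1) E[OF BA cB] by blast
        then show ?thesis using trans_omega1[OF _ w'r] r(2) by blast
      qed
      have "Q f w r" using r(1) lt unfolding Q_def B_def by blast
      then show ?thesis by blast
    qed (simp add: Q_def)
  qed
  then obtain a where a: "\<And>w. Q a w (a w)" by blast
  have aA: "a w \<in> A" if "w \<in> Field omega1" for w using a[of w] that unfolding Q_def by blast
  have aW: "a w \<in> Field omega1" if "w \<in> Field omega1" for w using aA[OF that] A(1) by blast
  have mono: "(a v, a w) \<in> omega1 - Id" if "(v, w) \<in> omega1 - Id" for v w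
    using a[of w] that omega1_Field unfolding Q_def by blast
  have "countable (Field omega1)"
  proof (rule countable_spread_isolated_family[OF spread, of _ "\<lambda>w. y (a w)"])
    fix w assume w: "w \<in> Field omega1"
    show "y (a w) \<in> topspace Y" using y_topspace aW w by blast
    define B where "B = a ` {v. (v, w) \<in> omega1 - Id}"
    have "B \<subseteq> A" using aA omega1_Field unfolding B_def by blast
    moreover have "countable B" unfolding B_def
      by (intro countable_image countable_subset[OF _ countable_under_omega1[of w]]) auto
    ultimately have EB: "finite (E B)" "E B \<subseteq> Field omega1" "y ` B \<subseteq> \<Union>(U ` E B)" using E by blast+
    have above: "(e, a w) \<in> omega1 - Id" if "e \<in> E B" for e
      using a[of w] w that unfolding Q_def B_def by blast
    define T where "T = U (a w) - \<Union>(C ` E B)"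
    have "openin Y T" unfolding T_def
      using EB(1,2) closedC by (intro openin_diff openU aW[OF w] closedin_Union) auto
    moreover have "y (a w) \<in> T"
    proof -
      have "y (a w) \<notin> C e" if "e \<in> E B" for e
        using separated[OF above[OF that]] C_V[of e] EB(2) that by blast
      then show ?thesis using y_U[OF aW[OF w]] unfolding T_def by blast
    qed
    moreover have "y (a v) \<notin> T" if v: "v \<in> Field omega1" "v \<noteq> w" for v
    proof (cases "(v, w) \<in> omega1")
      case True
      then have "a v \<in> B" using v(2) unfolding B_def by blast
      then obtain e where e: "e \<in> E B" "y (a v) \<in> U e" using EB(3) by blast
      then have "y (a v) \<in> C e" using U_C[of e] EB(2) by blast
      then show ?thesis using e(1) unfolding T_def by blast
    next
      case False
      then have "(w, v) \<in> omega1 - Id" using total_omega1 v w by blast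
      then have "y (a v) \<notin> V (a w)" using separated mono by blast
      then show ?thesis using U_C[OF aW[OF w]] C_V[OF aW[OF w]] unfolding T_def by blast
    qed
    ultimately show "\<exists>T. openin Y T \<and> y (a w) \<in> T \<and> (\<forall>v\<in>Field omega1. v \<noteq> w \<longrightarrow> y (a v) \<notin> T)" by blast
  qed
  then show False using uncountable_omega1 by blast
qed

text \<open>Only the point of smaller index is kept out of the neighbourhood of the other; the
  opposite direction is right separation. A clique therefore gives a discrete subspace.\<close>

definition R :: "nat set \<Rightarrow> nat set \<Rightarrow> bool" where
  "R v w \<longleftrightarrow> (v, w) \<in> omega1 - Id \<and> y v \<notin> U w \<or> (w, v) \<in> omega1 - Id \<and> y w \<notin> U v"

definition I :: "nat set set set" where
  "I = {Z. countable (Z \<inter> Field omega1)}"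

sublocale sigma_ideal I
proof
  fix A B assume "A \<in> I" "B \<subseteq> A"
  then have "countable (A \<inter> Field omega1)" "B \<inter> Field omega1 \<subseteq> A \<inter> Field omega1"
    by (auto simp: I_def)
  then show "B \<in> I" unfolding I_def using countable_subset by blast
next
  show "\<Union>\<A> \<in> I" if "countable \<A>" "\<A> \<subseteq> I" for \<A>
  proof -
    have "countable (Z \<inter> Field omega1)" if "Z \<in> \<A>" for Z
      using subsetD[OF \<open>\<A> \<subseteq> I\<close> that] by (simp add: I_def)
    then have "countable (\<Union>Z\<in>\<A>. Z \<inter> Field omega1)" by (rule countable_UN[OF \<open>countable \<A>\<close>])
    then show ?thesis unfolding I_def Int_Union2 by simp
  qed
  show "UNIV \<notin> I" using uncountable_omega1 by (simp add: I_def)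
qed

text \<open>The same \<open>E\<close> has to be escaped at every coordinate, so coordinates are
  found one at a time: the countable \<open>B\<close> offers a first coordinate, and the countable
  family attached to it by induction offers the rest.\<close>

lemma escaping_tuples:
  "\<not> null n F \<Longrightarrow> \<exists>F0\<subseteq>F. countable F0 \<and>
     (\<forall>E. finite E \<and> E \<subseteq> Field omega1 \<longrightarrow>
       (\<exists>xs\<in>F0. set xs \<subseteq> Field omega1 \<and> (\<forall>x\<in>set xs. \<forall>e\<in>E. y x \<notin> U e)))"
proof (induction n arbitrary: F)
  case 0
  then show ?case by (intro exI[of _ "{[]}"]) auto
next
  case (Suc n)
  define A where "A = {x. \<not> null n (sec F x)} \<inter> Field omega1"
  have "uncountable A" using Suc.prems unfolding A_def null.simps by (simp only: I_def mem_Collect_eq not_False_eq_True)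
  moreover have "A \<subseteq> Field omega1" unfolding A_def by (rule Int_lower2)
  ultimately have "\<exists>B\<subseteq>A. countable B \<and>
      (\<forall>E. finite E \<and> E \<subseteq> Field omega1 \<longrightarrow> (\<exists>b\<in>B. \<forall>e\<in>E. y b \<notin> U e))"
    by (intro escape_finite_unions)
  then obtain B where B: "B \<subseteq> A" "countable B"
      "\<forall>E. finite E \<and> E \<subseteq> Field omega1 \<longrightarrow> (\<exists>b\<in>B. \<forall>e\<in>E. y b \<notin> U e)"
    by (elim exE conjE)
  have "\<forall>b\<in>B. \<exists>G. G \<subseteq> sec F b \<and> countable G \<and> (\<forall>E. finite E \<and> E \<subseteq> Field omega1 \<longrightarrow>
       (\<exists>xs\<in>G. set xs \<subseteq> Field omega1 \<and> (\<forall>x\<in>set xs. \<forall>e\<in>E. y x \<notin> U e)))"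
    using Suc.IH B(1) unfolding A_def by blast
  then obtain G where G: "\<forall>b\<in>B. G b \<subseteq> sec F b \<and> countable (G b) \<and> (\<forall>E. finite E \<and> E \<subseteq> Field omega1 \<longrightarrow>
       (\<exists>xs\<in>G b. set xs \<subseteq> Field omega1 \<and> (\<forall>x\<in>set xs. \<forall>e\<in>E. y x \<notin> U e)))"
    by (rule bchoice[THEN exE])
  define F0 where "F0 = (\<Union>b\<in>B. (#) b ` G b)"
  have "F0 \<subseteq> F"
  proof
    fix xs assume "xs \<in> F0"
    then obtain b zs where "b \<in> B" "zs \<in> G b" "xs = b # zs" unfolding F0_def by blast
    moreover have "G b \<subseteq> sec F b" using bspec[OF G \<open>b \<in> B\<close>] by (rule conjunct1)
    ultimately show "xs \<in> F" by (auto simp: sec_def)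
  qed
  moreover have "countable F0"
    unfolding F0_def using G B(2) by (intro countable_UN countable_image) simp_all
  moreover have "\<exists>xs\<in>F0. set xs \<subseteq> Field omega1 \<and> (\<forall>x\<in>set xs. \<forall>e\<in>E. y x \<notin> U e)"
    if E: "finite E \<and> E \<subseteq> Field omega1" for E
  proof -
    obtain b where b: "b \<in> B" "\<forall>e\<in>E. y b \<notin> U e" using B(3)[THEN spec, THEN mp, OF E] by (elim bexE)
    have "\<exists>xs\<in>G b. set xs \<subseteq> Field omega1 \<and> (\<forall>x\<in>set xs. \<forall>e\<in>E. y x \<notin> U e)"
      using bspec[OF G b(1)] E by simp
    then obtain xs where xs: "xs \<in> G b" "set xs \<subseteq> Field omega1" "\<forall>x\<in>set xs. \<forall>e\<in>E. y x \<notin> U e" by blast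
    have "b \<in> Field omega1" using b(1) B(1) unfolding A_def by blast
    then show ?thesis using b xs unfolding F0_def by (intro bexI[of _ "b # xs"]) auto
  qed
  ultimately show ?case by blast
qed

sublocale clique_forcing I R
proof
  show "R w v" if "R v w" for v w using that unfolding R_def by blast
next
  fix F n assume F: "F \<subseteq> {xs. length xs = n \<and> distinct xs \<and> pairwise R (set xs)}"
  let ?bad = "\<lambda>F0. {ys \<in> F. \<forall>xs\<in>F0. \<not> (\<forall>x\<in>set xs. \<forall>y\<in>set ys. R x y)}"
  show "\<exists>F0\<subseteq>F. countable F0 \<and> null n (?bad F0)"
  proof (cases "null n F")
    case True
    then show ?thesis by (intro exI[of _ "{}"]) simp
  next
    case False
    obtain F0 where F0: "F0 \<subseteq> F" "countable F0"
      "\<forall>E. finite E \<and> E \<subseteq> Field omega1 \<longrightarrow>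
        (\<exists>xs\<in>F0. set xs \<subseteq> Field omega1 \<and> (\<forall>x\<in>set xs. \<forall>e\<in>E. y x \<notin> U e))"
      using escaping_tuples[OF False] by (elim exE conjE)
    \<comment> \<open>If \<open>ys\<close> has no coordinate in \<open>Z\<close>, its coordinates
      lie above all those of tuples in \<open>F0\<close>. Being joined to \<open>xs\<close> then
      only means that the points of \<open>xs\<close> miss the finitely many sets \<open>U d\<close>
      with \<open>d\<close> in \<open>ys\<close>.\<close>
    define Z where "Z = (\<Union>xs\<in>F0. \<Union>x\<in>set xs. {e. (e, x) \<in> omega1}) \<union> - Field omega1"
    have "countable (\<Union>xs\<in>F0. \<Union>x\<in>set xs. {e. (e, x) \<in> omega1})"
      using F0(2) countable_under_omega1 by (intro countable_UN) (auto intro: countable_finite)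
    then have "Z \<in> I" unfolding I_def Z_def by (auto intro: countable_subset[rotated])
    moreover have "?bad F0 \<subseteq> {ys. length ys = n \<and> (\<exists>x\<in>set ys. x \<in> Z)}"
    proof
      fix ys assume ys: "ys \<in> ?bad F0"
      have "\<exists>x\<in>set ys. x \<in> Z"
      proof (rule ccontr)
        assume notZ: "\<not> (\<exists>x\<in>set ys. x \<in> Z)"
        then have sub: "set ys \<subseteq> Field omega1" unfolding Z_def by blast
        then obtain xs where xs: "xs \<in> F0" "set xs \<subseteq> Field omega1" "\<forall>x\<in>set xs. \<forall>e\<in>set ys. y x \<notin> U e"
          using F0(3)[THEN spec, of "set ys"] by auto
        have "R x d" if x: "x \<in> set xs" and d: "d \<in> set ys" for x d
        proof -
          have "(d, x) \<notin> omega1" using notZ x d xs(1) unfolding Z_def by blast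
          moreover have "x \<in> Field omega1" "d \<in> Field omega1" using x d xs(2) sub by auto
          ultimately have "(x, d) \<in> omega1 - Id" using total_omega1 refl_omega1 by blast
          then show ?thesis using xs(3) x d unfolding R_def by blast
        qed
        then show False using ys xs(1) by blast
      qed
      moreover have "length ys = n" using ys F by blast
      ultimately show "ys \<in> {ys. length ys = n \<and> (\<exists>x\<in>set ys. x \<in> Z)}" by blast
    qed
    ultimately have "null n (?bad F0)" using null_mono null_coordinate by blast
    then show ?thesis using F0(1,2) by blast
  qed
qed

lemma PFA_contradiction:
  assumes "PFA TYPE(nat set set \<times> nat set list set set set)"
  shows False
proof -
  \<comment> \<open>Initial segments are small; a clique contained in none of them is unbounded and
    hence uncountable.\<close>
  define B where "B w = {v. (v, w) \<in> omega1} \<union> - Field omega1" for w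
  have "|Field omega1| \<le>o omega1"
    using card_of_Field_ordIso[OF cardSuc_Card_order[OF natLeq_Card_order]] ordIso_imp_ordLeq by blast
  moreover have "B w \<in> I" for w
    unfolding I_def B_def by (auto intro: countable_subset[OF _ countable_under_omega1[of w]])
  ultimately obtain K where K: "pairwise R K" "\<forall>w\<in>Field omega1. \<not> K \<subseteq> B w"
    using PFA_unbounded_clique[OF assms, of "Field omega1" B] by blast
  have "countable (K \<inter> Field omega1)"
  proof (rule countable_spread_isolated_family[OF spread, of _ y])
    fix w assume w: "w \<in> K \<inter> Field omega1"
    then show "y w \<in> topspace Y" using y_topspace by blast
    have "y v \<notin> U w" if v: "v \<in> K \<inter> Field omega1" "v \<noteq> w" for v
    proof -
      have "R v w" using pairwiseD[OF K(1)] v w by blast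
      moreover have "y v \<notin> U w" if "(w, v) \<in> omega1 - Id"
        using separated[OF that] U_C C_V w by blast
      ultimately show ?thesis unfolding R_def by blast
    qed
    then show "\<exists>T. openin Y T \<and> y w \<in> T \<and> (\<forall>v\<in>K \<inter> Field omega1. v \<noteq> w \<longrightarrow> y v \<notin> T)"
      using openU y_U w by blast
  qed
  then obtain w where w: "w \<in> Field omega1"
      "(K \<inter> Field omega1) \<inter> Field omega1 \<subseteq> {v. (v, w) \<in> omega1 - Id}"
    using countable_bounded_omega1 by blast
  then have "K \<subseteq> B w" unfolding B_def by blast
  then show False using K(2) w(1) by blast
qed

end

text \<open>If no countable subfamily has the full union, a recursion along omega1 picks points
  \<open>y w\<close> in members \<open>V w\<close> of \<open>\<U>\<close>, each point outside all
  earlier members. Regularity then supplies \<open>U w\<close> and \<open>C w\<close>.\<close>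

theorem PFA_hereditarily_Lindelof:
  assumes pfa: "PFA TYPE(nat set set \<times> nat set list set set set)"
    and reg: "regular_space Y" and spread: "countable_spread Y"
    and opens: "\<And>U. U \<in> \<U> \<Longrightarrow> openin Y U"
  shows "\<exists>\<V>\<subseteq>\<U>. countable \<V> \<and> \<Union>\<V> = \<Union>\<U>"
proof (rule ccontr)
  assume neg: "\<not> ?thesis"
  have uncov: "\<exists>z. z \<in> \<Union>\<U> \<and> z \<notin> \<Union>\<V>" if "\<V> \<subseteq> \<U>" "countable \<V>" for \<V>
  proof -
    have "\<Union>\<V> \<noteq> \<Union>\<U>" using neg that by auto
    then show ?thesis using Union_mono[OF that(1)] by auto
  qed
  define Q where "Q f w r \<longleftrightarrow> (w \<in> Field omega1 \<longrightarrow>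
    fst r \<in> snd r \<and> snd r \<in> \<U> \<and> (\<forall>v. (v, w) \<in> omega1 - Id \<longrightarrow> fst r \<notin> snd (f v)))"
    for f :: "nat set \<Rightarrow> 'a \<times> 'a set" and w r
  have "\<exists>f. \<forall>w. Q f w (f w)"
  proof (rule dependent_wf_choice[OF wf_omega1])
    fix f g :: "nat set \<Rightarrow> 'a \<times> 'a set" and w r
    assume "\<And>z. (z, w) \<in> omega1 - Id \<Longrightarrow> f z = g z"
    then show "Q f w r = Q g w r" unfolding Q_def by simp
  next
    fix w f assume IH: "\<And>v. (v, w) \<in> omega1 - Id \<Longrightarrow> Q f v (f v)"
    have "countable ((\<lambda>v. snd (f v)) ` {v. (v, w) \<in> omega1 - Id})"
      by (intro countable_image countable_subset[OF _ countable_under_omega1[of w]]) auto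
    moreover have "(\<lambda>v. snd (f v)) ` {v. (v, w) \<in> omega1 - Id} \<subseteq> \<U>"
    proof (rule image_subsetI)
      fix v assume "v \<in> {v. (v, w) \<in> omega1 - Id}"
      then have "Q f v (f v)" "v \<in> Field omega1" using IH by (auto simp: Field_def)
      then show "snd (f v) \<in> \<U>" unfolding Q_def by blast
    qed
    ultimately have "\<exists>z. z \<in> \<Union>\<U> \<and> z \<notin> \<Union>((\<lambda>v. snd (f v)) ` {v. (v, w) \<in> omega1 - Id})"
      by (intro uncov)
    then obtain z where z: "z \<in> \<Union>\<U>" "z \<notin> \<Union>((\<lambda>v. snd (f v)) ` {v. (v, w) \<in> omega1 - Id})"
      by (elim exE conjE)
    then obtain T where "z \<in> T" "T \<in> \<U>" by blast
    then have "Q f w (z, T)" using z(2) unfolding Q_def by auto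
    then show "\<exists>r. Q f w r" by blast
  qed
  then obtain f where f: "\<And>w. Q f w (f w)" by blast
  define y V where "y w = fst (f w)" and "V w = snd (f w)" for w
  have yV: "y w \<in> V w" "V w \<in> \<U>" if "w \<in> Field omega1" for w
    using f[of w] that unfolding Q_def y_def V_def by auto
  have sep: "y w \<notin> V v" if "(v, w) \<in> omega1 - Id" for v w
  proof -
    have "w \<in> Field omega1" using that by (auto simp: Field_def)
    then show ?thesis using f[of w] that unfolding Q_def y_def V_def by blast
  qed
  have "\<exists>UC. openin Y (fst UC) \<and> closedin Y (snd UC) \<and> y w \<in> fst UC \<and> fst UC \<subseteq> snd UC \<and> snd UC \<subseteq> V w"
    if "w \<in> Field omega1" for w
  proof -
    have "neighbourhood_base_of (closedin Y) Y" using reg neighbourhood_base_of_closedin by blast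
    then have "\<exists>U C. openin Y U \<and> closedin Y C \<and> y w \<in> U \<and> U \<subseteq> C \<and> C \<subseteq> V w"
      using opens[OF yV(2)[OF that]] yV(1)[OF that] unfolding neighbourhood_base_of by blast
    then show ?thesis by auto
  qed
  then have "\<forall>w\<in>Field omega1. \<exists>UC. openin Y (fst UC) \<and> closedin Y (snd UC) \<and> y w \<in> fst UC \<and> fst UC \<subseteq> snd UC \<and> snd UC \<subseteq> V w"
    by blast
  then obtain UC where UC: "\<forall>w\<in>Field omega1. openin Y (fst (UC w)) \<and> closedin Y (snd (UC w)) \<and>
      y w \<in> fst (UC w) \<and> fst (UC w) \<subseteq> snd (UC w) \<and> snd (UC w) \<subseteq> V w"
    by (rule bchoice[THEN exE])
  interpret right_separated Y y "\<lambda>w. fst (UC w)" V "\<lambda>w. snd (UC w)"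
    by unfold_locales (use spread UC sep in auto)
  show False using PFA_contradiction[OF pfa] .
qed


section \<open>Graphs generated by countably many rectangles\<close>

text \<open>The last assumption ties the ideal to the graph: a set outside \<open>I\<close> spans an
  edge. The pair \<open>({}, {})\<close> serves as filler on the diagonal of the matrices in
  \<open>separating\<close>.\<close>

locale countably_generated_graph = sigma_ideal I for I :: "'b set set" +
  fixes R :: "'b \<Rightarrow> 'b \<Rightarrow> bool" and T :: "('b set \<times> 'b set) set"
  assumes sym: "R x y \<Longrightarrow> R y x"
    and countable_T: "countable T" and empty_T: "({}, {}) \<in> T"
    and T_R: "t \<in> T \<Longrightarrow> x \<in> fst t \<Longrightarrow> y \<in> snd t \<Longrightarrow> R x y"
    and R_T: "R x y \<Longrightarrow> \<exists>t\<in>T. x \<in> fst t \<and> y \<in> snd t"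
    and independent: "(\<And>x y. x \<in> Z \<Longrightarrow> y \<in> Z \<Longrightarrow> \<not> R x y) \<Longrightarrow> Z \<in> I"
begin

section \<open>Amalgamation by pigeonhole on sequences of rectangles\<close>

definition in_box :: "('b set \<times> 'b set \<Rightarrow> 'b set) \<Rightarrow> 'b list \<Rightarrow> ('b set \<times> 'b set) list \<Rightarrow> bool" where
  "in_box side xs ts \<longleftrightarrow> list_all2 (\<lambda>x t. x \<in> side t) xs ts"

text \<open>There are countably many sequences \<open>ts\<close>, so a single one works for a set of
  first coordinates outside the ideal. This set spans an edge, and a rectangle containing the edge
  is put in front of \<open>ts\<close>. The two tuples obtained are joined coordinate by
  coordinate.\<close>

lemma linked_boxes:
  "\<not> null n G \<Longrightarrow> \<exists>ts\<in>lists T. (\<exists>xs\<in>G. in_box fst xs ts) \<and> (\<exists>xs\<in>G. in_box snd xs ts)"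
proof (induction n arbitrary: G)
  case 0
  then show ?case by (intro bexI[of _ "[]"]) (auto simp: in_box_def)
next
  case (Suc n)
  define A where "A ts = {x. (\<exists>xs\<in>sec G x. in_box fst xs ts) \<and> (\<exists>xs\<in>sec G x. in_box snd xs ts)}" for ts
  have "{x. \<not> null n (sec G x)} \<subseteq> (\<Union>ts\<in>lists T. A ts)"
  proof
    fix x assume "x \<in> {x. \<not> null n (sec G x)}"
    then have "\<exists>ts\<in>lists T. (\<exists>xs\<in>sec G x. in_box fst xs ts) \<and> (\<exists>xs\<in>sec G x. in_box snd xs ts)"
      by (intro Suc.IH) simp
    then show "x \<in> (\<Union>ts\<in>lists T. A ts)" by (simp add: A_def)
  qed
  moreover have "{x. \<not> null n (sec G x)} \<notin> I" using Suc.prems by simp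
  ultimately have "(\<Union>ts\<in>lists T. A ts) \<notin> I" using I_mono by blast
  moreover have "countable (A ` lists T)" using countable_T by (intro countable_image countable_lists)
  ultimately obtain ts where ts: "ts \<in> lists T" "A ts \<notin> I" using I_Union by blast
  then obtain x y where xy: "x \<in> A ts" "y \<in> A ts" "R x y" using independent by blast
  obtain t where t: "t \<in> T" "x \<in> fst t" "y \<in> snd t" using R_T[OF xy(3)] by blast
  obtain xs where "xs \<in> sec G x" "in_box fst xs ts" using xy(1) unfolding A_def by blast
  then have "x # xs \<in> G" "in_box fst (x # xs) (t # ts)" using t by (auto simp: sec_def in_box_def)
  moreover obtain ys where "ys \<in> sec G y" "in_box snd ys ts" using xy(2) unfolding A_def by blast
  then have "y # ys \<in> G" "in_box snd (y # ys) (t # ts)" using t by (auto simp: sec_def in_box_def)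
  moreover have "t # ts \<in> lists T" using t ts by simp
  ultimately show ?case by blast
qed

text \<open>One tuple is picked for each sequence of rectangles whose second sides contain a member
  of \<open>F\<close>. Were the tuples joined to no picked one not null, \<open>linked_boxes\<close>
  would find such a tuple in the first sides of one of these sequences, where it is joined to the
  picked tuple.\<close>

lemma coordinatewise_linked:
  "\<exists>F0\<subseteq>F. countable F0 \<and> null n {ys \<in> F. \<forall>xs\<in>F0. \<not> list_all2 R xs ys}"
proof -
  define J where "J = {ts \<in> lists T. \<exists>xs\<in>F. in_box snd xs ts}"
  define pick where "pick ts = (SOME xs. xs \<in> F \<and> in_box snd xs ts)" for ts
  have pick: "pick ts \<in> F \<and> in_box snd (pick ts) ts" if "ts \<in> J" for ts
    unfolding pick_def by (rule someI_ex) (use that in \<open>auto simp: J_def\<close>)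
  have "countable J" unfolding J_def using countable_T by (intro countable_Collect countable_lists)
  moreover have "null n {ys \<in> F. \<forall>xs\<in>pick ` J. \<not> list_all2 R xs ys}"
  proof (rule ccontr)
    assume "\<not> ?thesis"
    from linked_boxes[OF this] obtain ts ys xs where ts: "ts \<in> lists T"
      and ys: "ys \<in> F" "\<forall>xs\<in>pick ` J. \<not> list_all2 R xs ys" "in_box fst ys ts"
      and xs: "xs \<in> F" "in_box snd xs ts"
      by blast
    have J: "ts \<in> J" using ts xs unfolding J_def by blast
    have b: "in_box snd (pick ts) ts" using pick[OF J] by (rule conjunct2)
    have "list_all2 R (pick ts) ys"
    proof (rule list_all2_all_nthI)
      show "length (pick ts) = length ys" using b ys(3) by (simp add: in_box_def list_all2_lengthD)
      fix i assume i: "i < length (pick ts)"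
      then have "pick ts ! i \<in> snd (ts ! i)" using b unfolding in_box_def by (rule list_all2_nthD[rotated])
      moreover have "ys ! i \<in> fst (ts ! i)"
        using ys(3) b i unfolding in_box_def by (metis list_all2_lengthD list_all2_nthD2)
      moreover have "ts ! i \<in> T"
        using ts b i unfolding in_box_def by (metis in_listsD list_all2_lengthD nth_mem)
      ultimately show "R (pick ts ! i) (ys ! i)" using T_R sym by blast
    qed
    then show False using ys(2) J by blast
  qed
  moreover have "pick ` J \<subseteq> F" using pick by blast
  ultimately show ?thesis by (intro exI[of _ "pick ` J"]) simp
qed

text \<open>A matrix of rectangles witnessing all edges inside \<open>xs\<close>. Two tuples with a
  common matrix are joined at all pairs of different positions.\<close>

definition separating :: "('b set \<times> 'b set) list list \<Rightarrow> 'b list \<Rightarrow> bool" where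
  "separating m xs \<longleftrightarrow> (\<forall>i<length xs. \<forall>j<length xs. i \<noteq> j \<longrightarrow> xs ! i \<in> fst (m ! i ! j) \<and> xs ! j \<in> snd (m ! i ! j))"

lemma ex_separating:
  assumes "distinct xs" "pairwise R (set xs)"
  shows "\<exists>m\<in>{m \<in> lists (lists T). length m = length xs \<and> (\<forall>r\<in>set m. length r = length xs)}. separating m xs"
proof -
  define t where "t i j = (SOME t. t \<in> T \<and> (i \<noteq> j \<longrightarrow> xs ! i \<in> fst t \<and> xs ! j \<in> snd t))" for i j
  have t: "t i j \<in> T \<and> (i \<noteq> j \<longrightarrow> xs ! i \<in> fst (t i j) \<and> xs ! j \<in> snd (t i j))"
    if "i < length xs" "j < length xs" for i j
    unfolding t_def
  proof (rule someI_ex)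
    show "\<exists>t. t \<in> T \<and> (i \<noteq> j \<longrightarrow> xs ! i \<in> fst t \<and> xs ! j \<in> snd t)"
    proof (cases "i = j")
      case True
      then show ?thesis using empty_T by blast
    next
      case False
      then have "xs ! i \<noteq> xs ! j" using assms(1) that by (simp add: nth_eq_iff_index_eq)
      then have "R (xs ! i) (xs ! j)" using that by (intro pairwiseD[OF assms(2)] nth_mem)
      then show ?thesis using R_T by blast
    qed
  qed
  let ?m = "map (\<lambda>i. map (t i) [0..<length xs]) [0..<length xs]"
  have "separating ?m xs" using t by (simp add: separating_def)
  moreover have "?m \<in> lists (lists T)" using t by (auto simp: in_lists_conv_set)
  ultimately show ?thesis by (intro bexI[of _ ?m]) auto
qed

text \<open>Splitting \<open>F\<close> by its countably many separating matrices upgrades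
  coordinatewise joining to complete joining: the common matrix gives the edges between different
  positions, \<open>coordinatewise_linked\<close> those between equal positions.\<close>

sublocale clique_forcing I R
proof
  show "R y x" if "R x y" for x y using that by (rule sym)
next
  fix F n assume F: "F \<subseteq> {xs. length xs = n \<and> distinct xs \<and> pairwise R (set xs)}"
  define J where "J = {m \<in> lists (lists T). length m = n \<and> (\<forall>r\<in>set m. length r = n)}"
  have cJ: "countable J" unfolding J_def using countable_T by (intro countable_Collect countable_lists)
  define F' where "F' m = {xs \<in> F. separating m xs}" for m
  define F0 where "F0 m = (SOME G. G \<subseteq> F' m \<and> countable G \<and> null n {ys \<in> F' m. \<forall>xs\<in>G. \<not> list_all2 R xs ys})" for m
  have F0: "F0 m \<subseteq> F' m \<and> countable (F0 m) \<and> null n {ys \<in> F' m. \<forall>xs\<in>F0 m. \<not> list_all2 R xs ys}" for m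
    unfolding F0_def by (rule someI_ex) (rule coordinatewise_linked)
  let ?G = "\<Union>m\<in>J. F0 m"
  have sub: "{ys \<in> F. \<forall>xs\<in>?G. \<not> (\<forall>x\<in>set xs. \<forall>y\<in>set ys. R x y)} \<subseteq>
      (\<Union>m\<in>J. {ys \<in> F' m. \<forall>xs\<in>F0 m. \<not> list_all2 R xs ys})"
  proof
    fix ys assume ys: "ys \<in> {ys \<in> F. \<forall>xs\<in>?G. \<not> (\<forall>x\<in>set xs. \<forall>y\<in>set ys. R x y)}"
    then have len: "length ys = n" "distinct ys" "pairwise R (set ys)" using F by auto
    obtain m where m: "m \<in> J" "separating m ys"
      using ex_separating[OF len(2,3)] len(1) unfolding J_def by blast
    have "\<not> list_all2 R xs ys" if xs: "xs \<in> F0 m" for xs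
    proof
      assume l: "list_all2 R xs ys"
      have xsF: "xs \<in> F" "separating m xs" using F0[of m] xs unfolding F'_def by auto
      have lenx: "length xs = n" using xsF(1) F by auto
      have "R x y" if xy: "x \<in> set xs" "y \<in> set ys" for x y
      proof -
        obtain i where i: "i < n" "x = xs ! i" using xy(1) lenx unfolding in_set_conv_nth by blast
        obtain j where j: "j < n" "y = ys ! j" using xy(2) len(1) unfolding in_set_conv_nth by blast
        note ij = i j
        show ?thesis
        proof (cases "i = j")
          case True
          then show ?thesis using l ij lenx by (simp add: list_all2_nthD)
        next
          case False
          then have "x \<in> fst (m ! i ! j)" "y \<in> snd (m ! i ! j)"
            using xsF(2) m(2) ij lenx len(1) unfolding separating_def by auto
          moreover have "m ! i ! j \<in> T"
          proof -
            have "m ! i \<in> set m" using m(1) ij(1) by (auto simp: J_def)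
            then have "m ! i \<in> lists T" "length (m ! i) = n" using m(1) by (auto simp: J_def)
            then show ?thesis using ij(3) by (metis in_listsD nth_mem)
          qed
          ultimately show ?thesis using T_R by blast
        qed
      qed
      then show False using ys m(1) xs by blast
    qed
    then have "ys \<in> {ys \<in> F' m. \<forall>xs\<in>F0 m. \<not> list_all2 R xs ys}"
      using ys m(2) unfolding F'_def by blast
    then show "ys \<in> (\<Union>m\<in>J. {ys \<in> F' m. \<forall>xs\<in>F0 m. \<not> list_all2 R xs ys})" using m(1) by blast
  qed
  have "null n (\<Union>m\<in>J. {ys \<in> F' m. \<forall>xs\<in>F0 m. \<not> list_all2 R xs ys})"
    by (rule null_UN[OF cJ]) (use F0 in simp)
  then have "null n {ys \<in> F. \<forall>xs\<in>?G. \<not> (\<forall>x\<in>set xs. \<forall>y\<in>set ys. R x y)}" using sub by (rule null_mono)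
  moreover have "?G \<subseteq> F" using F0 unfolding F'_def by blast
  moreover have "countable ?G" using cJ F0 by (intro countable_UN) simp_all
  ultimately show "\<exists>F0\<subseteq>F. countable F0 \<and> null n {ys \<in> F. \<forall>xs\<in>F0. \<not> (\<forall>x\<in>set xs. \<forall>y\<in>set ys. R x y)}"
    by blast
qed

end

section \<open>The graph of an open partition on the product with omega1\<close>

locale OGA_counterexample =
  fixes X :: "'a topology" and K0 K1 :: "'a set set" and T0 :: "('a set \<times> 'a set) set"
  assumes partition: "nsets (topspace X) 2 = K0 \<union> K1"
    and countable_T0: "countable T0"
    and T0: "{(x, y). x \<in> topspace X \<and> y \<in> topspace X \<and> {x, y} \<in> K0} = (\<Union>(A, B)\<in>T0. A \<times> B)"
    and uncovered: "\<not> (\<exists>\<F>. countable \<F> \<and> (\<forall>Y\<in>\<F>. homogeneous K1 Y) \<and> \<Union>\<F> = topspace X)"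
begin

text \<open>
  Points carry an additional coordinate in \<open>\<omega>\<^sub>1\<close>, so that \<open>\<aleph>\<^sub>1\<close> many dense sets suffice to make
  the generic clique uncountable, whatever the cardinality of \<open>X\<close>.
\<close>

definition R :: "'a \<times> nat set \<Rightarrow> 'a \<times> nat set \<Rightarrow> bool" where
  "R p q \<longleftrightarrow> fst p \<in> topspace X \<and> fst q \<in> topspace X \<and> {fst p, fst q} \<in> K0"

definition T :: "(('a \<times> nat set) set \<times> ('a \<times> nat set) set) set" where
  "T = insert ({}, {}) ((\<lambda>(A, B). (A \<times> UNIV, B \<times> UNIV)) ` T0)"

definition tail :: "('a \<times> nat set) set \<Rightarrow> nat set \<Rightarrow> 'a set" where
  "tail Z w = {x \<in> topspace X. \<exists>v\<in>Field omega1. (v, w) \<notin> omega1 \<and> (x, v) \<in> Z}"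

text \<open>The ideal ignores second coordinates up to some \<open>w\<close>. Strips of bounded
  second coordinate are therefore small, while the whole product is not, since each of its tails
  projects onto the space.\<close>

definition I :: "('a \<times> nat set) set set" where
  "I = {Z. \<exists>w\<in>Field omega1. \<exists>\<F>. countable \<F> \<and> (\<forall>Y\<in>\<F>. homogeneous K1 Y) \<and> tail Z w \<subseteq> \<Union>\<F>}"

lemma K0_not_singleton: "{x, x} \<notin> K0"
proof
  assume "{x, x} \<in> K0"
  then have "{x} \<in> nsets (topspace X) 2" using partition by auto
  then show False by (simp add: nsets_def)
qed

sublocale sigma_ideal I
proof
  fix A B assume A: "A \<in> I" and BA: "B \<subseteq> A"
  obtain w \<F> where w: "w \<in> Field omega1" "countable \<F>" "\<forall>Y\<in>\<F>. homogeneous K1 Y" "tail A w \<subseteq> \<Union>\<F>"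
    using A unfolding I_def mem_Collect_eq by (elim bexE exE conjE)
  have "tail B w \<subseteq> \<Union>\<F>" using w(4) BA unfolding tail_def by blast
  then show "B \<in> I" using w(1-3) unfolding I_def mem_Collect_eq by (intro bexI exI conjI)
next
  fix \<A> assume \<A>: "countable \<A>" "\<A> \<subseteq> I"
  have "\<forall>Z\<in>\<A>. \<exists>w\<F>. fst w\<F> \<in> Field omega1 \<and> countable (snd w\<F>) \<and> (\<forall>Y\<in>snd w\<F>. homogeneous K1 Y) \<and>
      tail Z (fst w\<F>) \<subseteq> \<Union>(snd w\<F>)"
  proof
    fix Z assume "Z \<in> \<A>"
    then have "Z \<in> I" using \<A>(2) by blast
    then obtain w \<F> where "w \<in> Field omega1" "countable \<F>" "\<forall>Y\<in>\<F>. homogeneous K1 Y" "tail Z w \<subseteq> \<Union>\<F>"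
      unfolding I_def mem_Collect_eq by (elim bexE exE conjE)
    then show "\<exists>w\<F>. fst w\<F> \<in> Field omega1 \<and> countable (snd w\<F>) \<and> (\<forall>Y\<in>snd w\<F>. homogeneous K1 Y) \<and>
      tail Z (fst w\<F>) \<subseteq> \<Union>(snd w\<F>)" by (intro exI[of _ "(w, \<F>)"]) simp
  qed
  then obtain g where g: "\<forall>Z\<in>\<A>. fst (g Z) \<in> Field omega1 \<and> countable (snd (g Z)) \<and>
      (\<forall>Y\<in>snd (g Z). homogeneous K1 Y) \<and> tail Z (fst (g Z)) \<subseteq> \<Union>(snd (g Z))"
    by (rule bchoice[THEN exE])
  \<comment> \<open>One \<open>w\<close> above the bounds of all countably many members works for
    the union, as tails shrink when the bound grows.\<close>
  obtain w where w: "w \<in> Field omega1"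
      "(\<lambda>Z. fst (g Z)) ` \<A> \<inter> Field omega1 \<subseteq> {v. (v, w) \<in> omega1 - Id}"
    using countable_bounded_omega1[of "(\<lambda>Z. fst (g Z)) ` \<A>"] \<A>(1) by auto
  have "tail (\<Union>\<A>) w \<subseteq> \<Union>(\<Union>Z\<in>\<A>. snd (g Z))"
  proof
    fix x assume "x \<in> tail (\<Union>\<A>) w"
    then obtain v Z where x: "x \<in> topspace X" "v \<in> Field omega1" "(v, w) \<notin> omega1" "Z \<in> \<A>" "(x, v) \<in> Z"
      unfolding tail_def by blast
    have gZ: "fst (g Z) \<in> Field omega1" "tail Z (fst (g Z)) \<subseteq> \<Union>(snd (g Z))" using bspec[OF g x(4)] by auto
    have "(fst (g Z), w) \<in> omega1" using w(2) gZ(1) x(4) by blast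
    then have "(v, fst (g Z)) \<notin> omega1" using trans_omega1 x(3) by blast
    then have "x \<in> tail Z (fst (g Z))" using x unfolding tail_def by blast
    then show "x \<in> \<Union>(\<Union>Z\<in>\<A>. snd (g Z))" using gZ(2) x(4) by blast
  qed
  moreover have "countable (\<Union>Z\<in>\<A>. snd (g Z))" using \<A>(1) g by (intro countable_UN) simp_all
  moreover have "\<forall>Y\<in>(\<Union>Z\<in>\<A>. snd (g Z)). homogeneous K1 Y" using g by simp
  ultimately show "\<Union>\<A> \<in> I" using w(1) unfolding I_def mem_Collect_eq by (intro bexI exI conjI)
next
  show "UNIV \<notin> I"
  proof
    assume "UNIV \<in> I"
    then obtain w \<F> where w: "w \<in> Field omega1" "countable \<F>" "\<forall>Y\<in>\<F>. homogeneous K1 Y"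
        "tail UNIV w \<subseteq> \<Union>\<F>"
      unfolding I_def mem_Collect_eq by (elim bexE exE conjE)
    have "\<not> Field omega1 \<subseteq> {v. (v, w) \<in> omega1}"
      using uncountable_omega1 countable_under_omega1 countable_subset by blast
    then obtain v where "v \<in> Field omega1" "(v, w) \<notin> omega1" by blast
    then have "tail UNIV w = topspace X" unfolding tail_def by auto
    then have "\<Union>((\<lambda>Y. Y \<inter> topspace X) ` \<F>) = topspace X" using w(4) by auto
    moreover have "countable ((\<lambda>Y. Y \<inter> topspace X) ` \<F>)" using w(2) by (rule countable_image)
    moreover have "\<forall>Y\<in>(\<lambda>Y. Y \<inter> topspace X) ` \<F>. homogeneous K1 Y"
    proof
      fix Y assume "Y \<in> (\<lambda>Y. Y \<inter> topspace X) ` \<F>"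
      then obtain Y' where "Y' \<in> \<F>" "Y = Y' \<inter> topspace X" by blast
      then have "homogeneous K1 Y'" "Y \<subseteq> Y'" using w(3) by auto
      then show "homogeneous K1 Y" unfolding homogeneous_def using nsets_mono by (metis order_trans)
    qed
    ultimately show False using uncovered by (elim notE) (intro exI conjI)
  qed
qed

text \<open>Since \<open>R\<close> ignores second coordinates, every tail of an independent set
  projects to a \<open>K1\<close>-homogeneous set; any \<open>w\<close> can be taken.\<close>

lemma independent_small:
  assumes "\<And>p q. p \<in> Z \<Longrightarrow> q \<in> Z \<Longrightarrow> \<not> R p q"
  shows "Z \<in> I"
proof -
  obtain w where w: "w \<in> Field omega1" using uncountable_omega1 by (metis countable_empty equals0I)
  have "homogeneous K1 (tail Z w)" unfolding homogeneous_def
  proof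
    fix e assume e: "e \<in> nsets (tail Z w) 2"
    then obtain x y where xy: "e = {x, y}" "x \<in> tail Z w" "y \<in> tail Z w" by (auto simp: nsets_2_eq)
    then obtain u v where uv: "(x, u) \<in> Z" "(y, v) \<in> Z" "x \<in> topspace X" "y \<in> topspace X"
      unfolding tail_def by blast
    then have "{x, y} \<notin> K0" using assms[of "(x, u)" "(y, v)"] by (auto simp: R_def)
    moreover have "e \<in> nsets (topspace X) 2" using e nsets_mono[of "tail Z w" "topspace X"]
      unfolding tail_def by blast
    ultimately show "e \<in> K1" using partition xy(1) by blast
  qed
  then show ?thesis using w unfolding I_def mem_Collect_eq
    by (intro bexI[of _ w] exI[of _ "{tail Z w}"]) simp_all
qed

sublocale countably_generated_graph I R T
proof
  show "R q p" if "R p q" for p q using that unfolding R_def by (metis insert_commute)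
  show "countable T" unfolding T_def using countable_T0 by simp
  show "({}, {}) \<in> T" unfolding T_def by simp
  have R_iff: "R p q \<longleftrightarrow> (fst p, fst q) \<in> (\<Union>(A, B)\<in>T0. A \<times> B)" for p q
    unfolding T0[symmetric] R_def by simp
  show "R p q" if "t \<in> T" "p \<in> fst t" "q \<in> snd t" for t p q
  proof -
    have "t \<noteq> ({}, {})" using that(2) by auto
    then have "t \<in> (\<lambda>(A, B). (A \<times> UNIV, B \<times> UNIV)) ` T0" using that(1) by (simp add: T_def)
    then obtain A B where "(A, B) \<in> T0" "t = (A \<times> UNIV, B \<times> UNIV)" by auto
    then show ?thesis using that(2,3) unfolding R_iff by (intro UN_I[of "(A, B)"]) (auto simp: mem_Times_iff)
  qed
  show "\<exists>t\<in>T. p \<in> fst t \<and> q \<in> snd t" if pq: "R p q" for p q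
  proof -
    obtain A B where "(A, B) \<in> T0" "fst p \<in> A" "fst q \<in> B" using pq unfolding R_iff by blast
    then show ?thesis unfolding T_def by (intro bexI[of _ "(A \<times> UNIV, B \<times> UNIV)"]) (auto simp: mem_Times_iff)
  qed
  show "Z \<in> I" if "\<And>x y. x \<in> Z \<Longrightarrow> y \<in> Z \<Longrightarrow> \<not> R x y" for Z using that by (rule independent_small)
qed

text \<open>A clique contained in no strip has unbounded second coordinates and is uncountable. Its
  projection loses nothing, because points with equal first coordinate are never joined.\<close>

lemma PFA_uncountable_homogeneous:
  assumes "PFA TYPE(('a \<times> nat set) set \<times> ('a \<times> nat set) list set set set)"
  shows "\<exists>Y\<subseteq>topspace X. uncountable Y \<and> homogeneous K0 Y"
proof -
  define B :: "nat set \<Rightarrow> ('a \<times> nat set) set"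
    where "B w = {p. snd p \<in> Field omega1 \<longrightarrow> (snd p, w) \<in> omega1}" for w
  have "|Field omega1| \<le>o omega1"
    using card_of_Field_ordIso[OF cardSuc_Card_order[OF natLeq_Card_order]] ordIso_imp_ordLeq by blast
  moreover have "B w \<in> I" if "w \<in> Field omega1" for w
  proof -
    have "tail (B w) w = {}" unfolding tail_def B_def by auto
    then show ?thesis unfolding I_def mem_Collect_eq using that
      by (intro bexI[of _ w] exI[of _ "{}"]) simp_all
  qed
  ultimately have "\<exists>Y. pairwise R Y \<and> (\<forall>w\<in>Field omega1. \<not> Y \<subseteq> B w)"
    by (intro PFA_unbounded_clique[OF assms])
  then obtain Y where Y: "pairwise R Y" "\<forall>w\<in>Field omega1. \<not> Y \<subseteq> B w" by (elim exE conjE)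
  have unc: "uncountable Y"
  proof
    assume "countable Y"
    then obtain w where w: "w \<in> Field omega1" "snd ` Y \<inter> Field omega1 \<subseteq> {v. (v, w) \<in> omega1 - Id}"
      using countable_bounded_omega1[of "snd ` Y"] by auto
    then have "Y \<subseteq> B w" unfolding B_def by blast
    then show False using Y(2) w(1) by blast
  qed
  have inj: "inj_on fst Y"
  proof (rule inj_onI, rule ccontr)
    fix p q assume pq: "p \<in> Y" "q \<in> Y" "fst p = fst q" "p \<noteq> q"
    then have "R p q" using pairwiseD[OF Y(1)] by blast
    then show False using pq(3) K0_not_singleton unfolding R_def by metis
  qed
  have "fst ` Y \<subseteq> topspace X"
  proof (rule image_subsetI)
    fix p assume p: "p \<in> Y"
    \<comment> \<open>Membership in the space is read off from an edge, so a second point of the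
      clique is called for.\<close>
    have "Y \<noteq> {p}" using unc by auto
    then obtain q where "q \<in> Y" "p \<noteq> q" using p by blast
    then have "R p q" using pairwiseD[OF Y(1)] p by blast
    then show "fst p \<in> topspace X" unfolding R_def by blast
  qed
  moreover have "uncountable (fst ` Y)" using unc inj countable_image_inj_on by blast
  moreover have "homogeneous K0 (fst ` Y)" unfolding homogeneous_def
  proof
    fix e assume "e \<in> nsets (fst ` Y) 2"
    then obtain p q where "e = {fst p, fst q}" "p \<in> Y" "q \<in> Y" "fst p \<noteq> fst q" by (auto simp: nsets_2_eq)
    moreover from this have "R p q" using pairwiseD[OF Y(1)] by blast
    ultimately show "e \<in> K0" unfolding R_def by blast
  qed
  ultimately show ?thesis by blast
qed

end

section \<open>From hereditary Lindelofness of the square to the open graph axiom\<close>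

lemma ex_countable_rectangles:
  assumes pfa: "PFA TYPE(nat set set \<times> nat set list set set set)"
    and reg: "regular_space (prod_topology X Y)" and spread: "countable_spread (prod_topology X Y)"
    and W: "openin (prod_topology X Y) W"
  shows "\<exists>T. countable T \<and> W = (\<Union>(A, B)\<in>T. A \<times> B)"
proof -
  define \<U> where "\<U> = {A \<times> B | A B. openin X A \<and> openin Y B \<and> A \<times> B \<subseteq> W}"
  have opens: "openin (prod_topology X Y) U" if "U \<in> \<U>" for U
    using that unfolding \<U>_def by (auto simp: openin_prod_Times_iff)
  have "\<exists>\<V>\<subseteq>\<U>. countable \<V> \<and> \<Union>\<V> = \<Union>\<U>"
    using pfa reg spread opens by (rule PFA_hereditarily_Lindelof)
  then obtain \<V> where \<V>: "\<V> \<subseteq> \<U>" "countable \<V>" "\<Union>\<V> = \<Union>\<U>" by (elim exE conjE)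
  have "\<Union>\<U> = W"
  proof
    show "\<Union>\<U> \<subseteq> W" unfolding \<U>_def by blast
    show "W \<subseteq> \<Union>\<U>"
    proof
      fix p assume p: "p \<in> W"
      then have "(fst p, snd p) \<in> W" by simp
      then obtain A B where "openin X A" "openin Y B" "fst p \<in> A" "snd p \<in> B" "A \<times> B \<subseteq> W"
        using W unfolding openin_prod_topology_alt by meson
      then have "A \<times> B \<in> \<U>" "p \<in> A \<times> B" unfolding \<U>_def by (auto simp: mem_Times_iff)
      then show "p \<in> \<Union>\<U>" by blast
    qed
  qed
  \<comment> \<open>The sides are recovered by projection. If one side is empty, both projections
    are empty, and the product is still \<open>V\<close>.\<close>
  moreover have "fst ` V \<times> snd ` V = V" if V: "V \<in> \<V>" for V
  proof -
    obtain A B where "V = A \<times> B" using V \<V>(1) unfolding \<U>_def by blast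
    then show ?thesis by (auto simp: image_iff)
  qed
  ultimately have "W = (\<Union>(A, B)\<in>(\<lambda>V. (fst ` V, snd ` V)) ` \<V>. A \<times> B)" using \<V>(3) by simp
  then show ?thesis using \<V>(2) by (intro exI[of _ "(\<lambda>V. (fst ` V, snd ` V)) ` \<V>"]) simp
qed

theorem corollary5p4:
  assumes "PFA TYPE('a set set set set)"
  shows "\<forall>X :: 'a topology.
    regular_space X \<and> countable_spread X \<and> countable_spread (prod_topology X X) \<longrightarrow> OGA X"
proof (intro allI impI, elim conjE)
  fix X :: "'a topology"
  assume reg: "regular_space X" and spread: "countable_spread (prod_topology X X)"
  show "OGA X" unfolding OGA_def
  proof (intro allI impI, elim conjE)
    fix K0 K1
    assume partition: "nsets (topspace X) 2 = K0 \<union> K1" and opn: "open_pairs X K0"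
    show "(\<exists>Y\<subseteq>topspace X. uncountable Y \<and> homogeneous K0 Y) \<or>
        (\<exists>\<F>. countable \<F> \<and> (\<forall>Y\<in>\<F>. homogeneous K1 Y) \<and> \<Union>\<F> = topspace X)"
    proof (rule disjCI)
      assume uncovered: "\<not> (\<exists>\<F>. countable \<F> \<and> (\<forall>Y\<in>\<F>. homogeneous K1 Y) \<and> \<Union>\<F> = topspace X)"
      \<comment> \<open>Singletons are vacuously homogeneous and would cover a countable space.
        Hence the type of points is infinite, as the embeddings of the condition types
        require.\<close>
      have "uncountable (topspace X)"
      proof
        assume "countable (topspace X)"
        then have "countable ((\<lambda>x. {x}) ` topspace X)" by (rule countable_image)
        moreover have "\<forall>Y\<in>(\<lambda>x. {x}) ` topspace X. homogeneous K1 Y"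
          by (auto simp: homogeneous_def nsets_2_eq)
        moreover have "\<Union>((\<lambda>x. {x}) ` topspace X) = topspace X" by simp
        ultimately show False using uncovered by (elim notE) (intro exI conjI)
      qed
      then have inf: "infinite (UNIV :: 'a set)"
        by (metis countable_finite finite_subset subset_UNIV)
      obtain e :: "nat \<Rightarrow> 'a" where "inj e" using ex_inj_nat[OF inf] by blast
      then have nat_set: "\<exists>f :: nat set \<Rightarrow> 'a set. inj f" using inj_image by blast
      have "infinite (UNIV :: 'a set set)" using inf by (simp add: Finite_Set.finite_set)
      then have pairs: "\<exists>f :: 'a \<times> nat set \<Rightarrow> 'a set. inj f"
        using ex_inj_Times[OF ex_inj_set nat_set] by blast
      have pfa1: "PFA TYPE(nat set set \<times> nat set list set set set)"
        using ex_inj_conditions[OF inf nat_set] PFA_inj assms by (elim exE) blast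
      have pfa2: "PFA TYPE(('a \<times> nat set) set \<times> ('a \<times> nat set) list set set set)"
        using ex_inj_conditions[OF inf pairs] PFA_inj assms by (elim exE) blast
      have "regular_space (prod_topology X X)" using reg by (simp add: regular_space_prod_topology)
      then have "\<exists>T. countable T \<and>
          {(x, y). x \<in> topspace X \<and> y \<in> topspace X \<and> {x, y} \<in> K0} = (\<Union>(A, B)\<in>T. A \<times> B)"
        using opn unfolding open_pairs_def by (intro ex_countable_rectangles[OF pfa1 _ spread])
      then obtain T where "countable T"
          "{(x, y). x \<in> topspace X \<and> y \<in> topspace X \<and> {x, y} \<in> K0} = (\<Union>(A, B)\<in>T. A \<times> B)"
        by (elim exE conjE)
      then interpret OGA_counterexample X K0 K1 T
        by unfold_locales (use partition uncovered in blast)+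
      show "\<exists>Y\<subseteq>topspace X. uncountable Y \<and> homogeneous K0 Y"
        by (rule PFA_uncountable_homogeneous[OF pfa2])
    qed
  qed
qed

end
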